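(* Let $U\subset\mathbb{R}^n$ be open and let $\mathcal{F}$ be a set-valued map assigning to each $x\in U$ a set $\mathcal{F}(x)\subset\mathbb{R}^n$. Suppose that $\mathcal{F}(x)$ is closed and convex for every $x\in U$ and that $\mathcal{F}$ is Lipschitzian, i.e. there exists $L>0$ such that $\mathcal{F}(x_1)\subset\mathcal{F}(x_2)+L|x_1-x_2|B_1(0)$ for all $x_1,x_2\in U$, where $B_1(0)=\{y\in\mathbb{R}^n:|y|\le1\}$. If the differential inclusion $\dot x\in\mathcal{F}(x)$ admits an invariant probability measure $\mu$, then there exists an open set $A\subset U$ such that $\mathrm{Sat}(\mathcal{N}_{\mathcal{F}})\subset A$ and $\mu(A)=0$.
   Context: A solution of $\dot x\in\mathcal{F}(x)$ on an interval $I\subset\mathbb{R}$ is an absolutely continuous function $\phi:I\to U$ with $\dot\phi(t)\in\mathcal{F}(\phi(t))$ for almost every $t\in I$. For $x\in U$, $\mathcal{S}_{\mathcal{F}}(x)$ denotes the set of all maximal solutions $\phi$, defined on an interval $I_{x,\phi}\ni 0$, with $\phi(0)=x$. Saturation: $\mathrm{Sat}(x)=\bigcup_{\phi\in\mathcal{S}_{\mathcal{F}}(x)}\{\phi(t):t\in I_{x,\phi}\}$ and $\mathrm{Sat}(V)=\bigcup_{x\in V}\mathrm{Sat}(x)$ for $V\subset U$. Nonuniqueness set: $\mathcal{N}_{\mathcal{F}}$ is the set of $x\in U$ such that $\mathcal{S}_{\mathcal{F}}(x)$ has more than one element. Invariant measure: for $A\subset U$ and $t\in\mathbb{R}$ let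 $\mathcal{S}_{\mathcal{F}}(A)(t)=\bigcup_{x\in A}\{\phi(t):\phi\in\mathcal{S}_{\mathcal{F}}(x),\ t\in I_{x,\phi}\}$. A Borel probability measure $\mu$ on $U$ is invariant for (preserved by) the differential inclusion if $\mu(\mathcal{S}_{\mathcal{F}}(A)(t))=\mu(A)$ for every Borel set $A\subset U$ and every $t\in\mathbb{R}$. *)

theory Defs
  imports "HOL-Analysis.Analysis" "HOL-Probability.Probability_Measure"
begin

text \<open>
  Absolute continuity in the usual epsilon-delta sense. A family \<open>D\<close> with
  \<open>D division_of \<Union>D\<close> is a finite family of nonempty compact intervals
  with pairwise disjoint interiors.
\<close>

definition abs_continuous_on_cbox :: "real \<Rightarrow> real \<Rightarrow> (real \<Rightarrow> 'a::real_normed_vector) \<Rightarrow> bool" where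
  "abs_continuous_on_cbox a b f \<longleftrightarrow>
     (\<forall>\<epsilon>>0. \<exists>\<delta>>0. \<forall>D. D division_of \<Union>D \<longrightarrow> \<Union>D \<subseteq> {a..b} \<longrightarrow>
        (\<Sum>k\<in>D. Sup k - Inf k) < \<delta> \<longrightarrow> (\<Sum>k\<in>D. norm (f (Sup k) - f (Inf k))) < \<epsilon>)"

text \<open>
  On an interval that is not compact, absolute continuity of a solution means, as usual
  for differential equations, absolute continuity on every compact subinterval
  (\<open>exp\<close> must be a solution of \<open>x' = x\<close> on the whole line).
\<close>

definition abs_continuous_on :: "real set \<Rightarrow> (real \<Rightarrow> 'a::real_normed_vector) \<Rightarrow> bool" where
  "abs_continuous_on I f \<longleftrightarrow> (\<forall>a b. a \<le> b \<longrightarrow> {a..b} \<subseteq> I \<longrightarrow> abs_continuous_on_cbox a b f)"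

text \<open>
  Throughout, only the values of \<open>F\<close> on \<open>U\<close> matter. The derivative is taken within
  \<open>I\<close>, which differs from the two-sided derivative at most at the endpoints of \<open>I\<close>.
\<close>

definition di_solution ::
  "(real^'n) set \<Rightarrow> (real^'n \<Rightarrow> (real^'n) set) \<Rightarrow> real set \<Rightarrow> (real \<Rightarrow> real^'n) \<Rightarrow> bool" where
  "di_solution U F I \<phi> \<longleftrightarrow>
     is_interval I \<and> \<phi> ` I \<subseteq> U \<and> abs_continuous_on I \<phi> \<and>
     (AE t in lborel. t \<in> I \<longrightarrow> (\<exists>v \<in> F (\<phi> t). (\<phi> has_vector_derivative v) (at t within I)))"

definition di_maximal_solution ::
  "(real^'n) set \<Rightarrow> (real^'n \<Rightarrow> (real^'n) set) \<Rightarrow> real set \<Rightarrow> (real \<Rightarrow> real^'n) \<Rightarrow> bool" where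
  "di_maximal_solution U F I \<phi> \<longleftrightarrow>
     di_solution U F I \<phi> \<and>
     (\<forall>J \<psi>. di_solution U F J \<psi> \<longrightarrow> I \<subseteq> J \<longrightarrow> (\<forall>t\<in>I. \<psi> t = \<phi> t) \<longrightarrow> J = I)"

text \<open>
  A maximal solution is represented by the pair of its interval of definition and a total
  function; \<open>extensional\<close> fixes the irrelevant values outside the interval, so that two
  pairs are equal iff they represent the same partial function.
\<close>

definition max_solutions ::
  "(real^'n) set \<Rightarrow> (real^'n \<Rightarrow> (real^'n) set) \<Rightarrow> real^'n \<Rightarrow> (real set \<times> (real \<Rightarrow> real^'n)) set" where
  "max_solutions U F x =
     {(I, \<phi>). \<phi> \<in> extensional I \<and> di_maximal_solution U F I \<phi> \<and> 0 \<in> I \<and> \<phi> 0 = x}"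

definition saturation ::
  "(real^'n) set \<Rightarrow> (real^'n \<Rightarrow> (real^'n) set) \<Rightarrow> (real^'n) set \<Rightarrow> (real^'n) set" where
  "saturation U F V = (\<Union>x\<in>V. \<Union>(I, \<phi>)\<in>max_solutions U F x. \<phi> ` I)"

definition nonuniqueness_set ::
  "(real^'n) set \<Rightarrow> (real^'n \<Rightarrow> (real^'n) set) \<Rightarrow> (real^'n) set" where
  "nonuniqueness_set U F =
     {x \<in> U. \<exists>p \<in> max_solutions U F x. \<exists>q \<in> max_solutions U F x. p \<noteq> q}"

definition solution_image ::
  "(real^'n) set \<Rightarrow> (real^'n \<Rightarrow> (real^'n) set) \<Rightarrow> (real^'n) set \<Rightarrow> real \<Rightarrow> (real^'n) set" where
  "solution_image U F A t = (\<Union>x\<in>A. {\<phi> t | I \<phi>. (I, \<phi>) \<in> max_solutions U F x \<and> t \<in> I})"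

text \<open>
  The image of a Borel set under \<open>solution_image\<close> need not be Borel, so its measure is
  taken in the completion of \<open>M\<close>, which agrees with \<open>M\<close> on Borel sets.
\<close>

definition invariant_prob_measure ::
  "(real^'n) set \<Rightarrow> (real^'n \<Rightarrow> (real^'n) set) \<Rightarrow> (real^'n) measure \<Rightarrow> bool" where
  "invariant_prob_measure U F M \<longleftrightarrow>
     prob_space M \<and> sets M = sets (restrict_space borel U) \<and>
     (\<forall>A \<in> sets M. \<forall>t. emeasure (completion M) (solution_image U F A t) = emeasure M A)"

definition lipschitzian_on ::
  "(real^'n) set \<Rightarrow> (real^'n \<Rightarrow> (real^'n) set) \<Rightarrow> bool" where
  "lipschitzian_on U F \<longleftrightarrow>
     (\<exists>L>0. \<forall>x1\<in>U. \<forall>x2\<in>U.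
        F x1 \<subseteq> {y + (L * norm (x1 - x2)) *\<^sub>R b | y b. y \<in> F x2 \<and> b \<in> cball 0 1})"

end

theory Submission
  imports Defs
begin

text \<open>
  Call \<open>y\<close> reachable from \<open>x\<close> in time \<open>t\<close> if some solution leads from \<open>x\<close> at time \<open>0\<close>
  to \<open>y\<close> at time \<open>t\<close>. This relation is reversible, and Filippov's theorem makes it lower
  semicontinuous: points near \<open>x\<close> reach points near \<open>y\<close>. Hence \<open>solution_image\<close> maps
  open sets to open sets, and no question of measurability arises.

  If two solutions from \<open>x\<close> satisfy \<open>y \<noteq> z\<close> at time \<open>t\<close>, take a small neighbourhood \<open>B\<close> of \<open>x\<close>
  from all of whose points small disjoint balls around \<open>y\<close> and \<open>z\<close> are reached. The parts \<open>P\<close>,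
  \<open>Q\<close> of the image of \<open>B\<close> in these balls both flow back over \<open>B\<close>, so each has measure at least
  \<open>\<mu> B\<close>, while together they lie in a set of measure \<open>\<mu> B\<close>; thus \<open>\<mu> B = 0\<close>.
  The images of these null neighbourhoods are open null sets that cover the saturation, and the
  union of all open null sets is null by second countability.
\<close>

section \<open>Differentiation of indefinite integrals\<close>

text \<open>The values of \<open>F\<close> are closed and convex but may be unbounded, so a
  perturbed solution cannot simply be extracted by compactness from approximate ones. Convexity is
  used through the nearest-point projection instead: it is single-valued and jointly continuous in
  position and velocity, hence projected velocities are measurable without any selection theorem,
  and a contraction argument yields the perturbed solution explicitly. The perturbed curve is the
  old one plus an indefinite integral. To see that it is again a solution one needs that such
  integrals are differentiable almost everywhere with the right derivative, and that absolute
  continuity survives sums; gluing and time reversal need the corresponding facts for concatenation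
  and reflection. Maximality matters only for translating the statement: every solution extends to a
  maximal one, and two distinct maximal solutions differ at a common time. Everything else concerns
  solutions on the compact interval between \<open>0\<close> and \<open>t\<close>.\<close>

text \<open>
  Intervals around \<open>x\<close> on which the average deviates from \<open>f x\<close> form a Vitali cover; by Henstock's
  lemma the total length of disjoint ones is small.
\<close>

lemma negligible_deviating_averages:
  fixes f :: "real \<Rightarrow> 'a::euclidean_space"
  assumes f: "f integrable_on {a..b}" and "e > 0"
  shows "negligible {x. \<forall>d>0. \<exists>u v. a \<le> u \<and> u \<le> x \<and> x \<le> v \<and> v \<le> b \<and> u < v \<and> v - u < d \<and>
           e * (v - u) \<le> norm ((v - u) *\<^sub>R f x - integral {u..v} f)}" (is "negligible ?E")
  unfolding negligible_outer_le
proof (intro allI impI)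
  fix \<epsilon> :: real assume "\<epsilon> > 0"
  \<comment> \<open>Vitali's theorem speaks of balls: the interval \<open>{u..v}\<close> with tag
    \<open>x\<close> is indexed by the triple and viewed as the closed ball about its midpoint,
    which need not be the tag.\<close>
  define mid where "mid = (\<lambda>(x::real, u::real, v::real). (u + v) / 2)"
  define rad where "rad = (\<lambda>(x::real, u::real, v::real). (v - u) / 2)"
  have cball_mid: "cball (mid i) (rad i) = {fst (snd i)..snd (snd i)}" for i
  proof -
    obtain x u v where i: "i = (x, u, v)" by (cases i)
    have "(u + v) / 2 - (v - u) / 2 = u" by argo
    moreover have "(u + v) / 2 + (v - u) / 2 = v" by argo
    ultimately show ?thesis
      unfolding i mid_def rad_def cball_eq_atLeastAtMost by (simp only: prod.case fst_conv snd_conv)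
  qed
  \<comment> \<open>Each bad interval contributes at least \<open>e\<close> times its length to the
    Henstock sum, so a sum below \<open>e * \<epsilon>\<close> means total length below
    \<open>\<epsilon>\<close>.\<close>
  have "e * \<epsilon> > 0" using \<open>e > 0\<close> \<open>\<epsilon> > 0\<close> by simp
  then obtain \<gamma> where "gauge \<gamma>"
    and \<gamma>: "\<And>p. \<lbrakk>p tagged_partial_division_of (cbox a b); \<gamma> fine p\<rbrakk> \<Longrightarrow>
             sum (\<lambda>(x,k). norm(measure lborel k *\<^sub>R f x - integral k f)) p < e * \<epsilon>"
    using Henstock_lemma[OF f[folded cbox_interval] \<open>e * \<epsilon> > 0\<close>] by blast
  define K where "K = {(x, u, v). a \<le> u \<and> u \<le> x \<and> x \<le> v \<and> v \<le> b \<and> u < v \<and> {u..v} \<subseteq> \<gamma> x \<and>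
           e * (v - u) \<le> norm ((v - u) *\<^sub>R f x - integral {u..v} f)}"
  obtain C where C: "countable C" "C \<subseteq> K"
     "pairwise (\<lambda>i j. disjnt (cball (mid i) (rad i)) (cball (mid j) (rad j))) C"
     "negligible (?E - (\<Union>i \<in> C. cball (mid i) (rad i)))"
  proof (rule Vitali_covering_theorem_cballs[of K rad ?E mid])
    show "0 < rad i" if "i \<in> K" for i
      using that by (cases i) (simp add: K_def rad_def)
    fix x d :: real assume x: "x \<in> ?E" and "0 < d"
    obtain r where "r > 0" and r: "ball x r \<subseteq> \<gamma> x"
      using \<open>gauge \<gamma>\<close> by (meson gauge_def openE)
    \<comment> \<open>The interval has to be short for the Vitali cover (\<open>d\<close>) and fine
      for the gauge (\<open>r\<close>).\<close>
    have "min d r > 0" using \<open>0 < d\<close> \<open>r > 0\<close> by simp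
    with x obtain u v where uv: "a \<le> u" "u \<le> x" "x \<le> v" "v \<le> b" "u < v" "v - u < min d r"
           "e * (v - u) \<le> norm ((v - u) *\<^sub>R f x - integral {u..v} f)"
      by blast
    have "{u..v} \<subseteq> ball x r"
      using uv by (auto simp: dist_real_def abs_less_iff)
    with uv r show "\<exists>i. i \<in> K \<and> x \<in> cball (mid i) (rad i) \<and> rad i < d"
      by (intro exI[of _ "(x, u, v)"] conjI)
         (auto simp: K_def cball_mid, simp add: rad_def)
  qed
  define B where "B i = cball (mid i) (rad i)" for i
  \<comment> \<open>Henstock's lemma concerns finite families only; a bound uniform over finite
    subfamilies passes to the countable union.\<close>
  have fin: "measure lebesgue (\<Union>(B ` I)) \<le> \<epsilon>" if "I \<subseteq> C" "finite I" for I
  proof -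
    define p where "p = (\<lambda>i. (fst i, B i)) ` I"
    have IK: "I \<subseteq> K" using that C by auto
    have B_eq: "B i = cbox (fst (snd i)) (snd (snd i))" for i
      by (simp add: B_def cball_mid)
    have in_K: "fst i \<in> B i \<and> B i \<subseteq> {a..b} \<and> B i \<subseteq> \<gamma> (fst i) \<and> measure lborel (B i) = snd (snd i) - fst (snd i) \<and>
         e * measure lborel (B i) \<le> norm (measure lborel (B i) *\<^sub>R f (fst i) - integral (B i) f)"
      if "i \<in> I" for i
    proof -
      have "i \<in> K" using that IK by auto
      moreover obtain x u v where "i = (x, u, v)" by (cases i) auto
      ultimately show ?thesis
        by (auto simp: B_eq K_def)
    qed
    have disj: "B i \<inter> B j = {}" if "i \<in> I" "j \<in> I" "i \<noteq> j" for i j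
      using C(3) that \<open>I \<subseteq> C\<close> by (auto simp: pairwise_def disjnt_def B_def)
    have inj: "inj_on (\<lambda>i. (fst i, B i)) I"
    proof (rule inj_onI)
      fix i j assume ij: "i \<in> I" "j \<in> I" "(fst i, B i) = (fst j, B j)"
      then show "i = j"
        using disj[of i j] in_K[of i] by auto
    qed
    have "p tagged_partial_division_of cbox a b"
      unfolding tagged_partial_division_of_def
    proof (intro conjI allI impI)
      show "finite p" using that by (simp add: p_def)
      fix x k assume "(x, k) \<in> p"
      then obtain i where i: "i \<in> I" "x = fst i" "k = B i" by (auto simp: p_def)
      then show "x \<in> k" "k \<subseteq> cbox a b" using in_K[of i] by auto
      show "\<exists>a b. k = cbox a b" using i B_eq by auto
    next
      fix x k x' k' assume *: "(x, k) \<in> p \<and> (x', k') \<in> p \<and> (x, k) \<noteq> (x', k')"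
      then obtain i where i: "i \<in> I" "x = fst i" "k = B i" by (auto simp: p_def)
      from * obtain j where j: "j \<in> I" "x' = fst j" "k' = B j" by (auto simp: p_def)
      from * i j have "i \<noteq> j" by auto
      then show "interior k \<inter> interior k' = {}"
        using disj[of i j] i j interior_subset by blast
    qed
    moreover have "\<gamma> fine p"
      using in_K by (auto simp: fine_def p_def)
    ultimately have "sum (\<lambda>(x,k). norm(measure lborel k *\<^sub>R f x - integral k f)) p < e * \<epsilon>"
      by (rule \<gamma>)
    then have s: "(\<Sum>i\<in>I. norm (measure lborel (B i) *\<^sub>R f (fst i) - integral (B i) f)) < e * \<epsilon>"
      unfolding p_def by (simp add: sum.reindex[OF inj])
    have "measure lebesgue (\<Union>(B ` I)) \<le> (\<Sum>i\<in>I. measure lebesgue (B i))"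
      by (rule measure_UNION_le) (use that in \<open>auto simp: B_def\<close>)
    also have "\<dots> = (\<Sum>i\<in>I. measure lborel (B i))"
      by (simp add: B_def measure_completion)
    finally have "measure lebesgue (\<Union>(B ` I)) \<le> (\<Sum>i\<in>I. measure lborel (B i))" .
    then have "e * measure lebesgue (\<Union>(B ` I)) \<le> (\<Sum>i\<in>I. e * measure lborel (B i))"
      using \<open>e > 0\<close> by (simp add: sum_distrib_left[symmetric])
    also have "\<dots> \<le> (\<Sum>i\<in>I. norm (measure lborel (B i) *\<^sub>R f (fst i) - integral (B i) f))"
      using in_K by (intro sum_mono) blast
    also have "\<dots> \<le> e * \<epsilon>" using s by simp
    finally show ?thesis using \<open>e > 0\<close> by simp
  qed
  have B: "B i \<in> lmeasurable" for i by (simp add: B_def)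
  have "\<Union>(B ` C) \<in> lmeasurable" by (rule fmeasurable_UN_bound[OF C(1) B fin])
  moreover have "measure lebesgue (\<Union>(B ` C)) \<le> \<epsilon>" by (rule measure_UN_bound[OF C(1) B fin])
  moreover have N: "?E - \<Union>(B ` C) \<in> null_sets lebesgue"
    using C(4) unfolding negligible_iff_null_sets B_def .
  ultimately have "\<Union>(B ` C) \<union> (?E - \<Union>(B ` C)) \<in> lmeasurable"
    and "measure lebesgue (\<Union>(B ` C) \<union> (?E - \<Union>(B ` C))) \<le> \<epsilon>"
    by (simp_all only: fmeasurable.Un fmeasurableI_null_sets measure_Un_null_set fmeasurableD)
  moreover have "?E \<subseteq> \<Union>(B ` C) \<union> (?E - \<Union>(B ` C))"
    unfolding Un_Diff_cancel by (rule Un_upper2)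
  ultimately show "\<exists>T. ?E \<subseteq> T \<and> T \<in> lmeasurable \<and> measure lebesgue T \<le> \<epsilon>"
    by (intro exI conjI)
qed

text \<open>Outside the sets \<open>E n\<close> every deviation \<open>inverse (Suc n)\<close> is
  beaten at small scales, which is differentiability with derivative \<open>f t\<close>. The
  intervals in \<open>E n\<close> may have \<open>t\<close> as an endpoint, so left and right
  difference quotients are both controlled. Countably many \<open>n\<close> suffice.\<close>

lemma indefinite_integral_has_vector_derivative_AE:
  fixes f :: "real \<Rightarrow> 'a::euclidean_space"
  assumes f: "f integrable_on {a..b}"
  shows "AE t in lborel. t \<in> {a<..<b} \<longrightarrow>
           ((\<lambda>s. integral {a..s} f) has_vector_derivative f t) (at t)"
proof -
  define E where "E n = {x. \<forall>d>0. \<exists>u v. a \<le> u \<and> u \<le> x \<and> x \<le> v \<and> v \<le> b \<and> u < v \<and> v - u < d \<and>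
           inverse (Suc n) * (v - u) \<le> norm ((v - u) *\<^sub>R f x - integral {u..v} f)}" for n :: nat
  have "negligible (E n)" for n
    unfolding E_def by (rule negligible_deviating_averages[OF f]) simp
  then have "negligible (\<Union>n. E n)"
    by (intro negligible_countable_Union) auto
  then have "AE t in lebesgue. t \<notin> (\<Union>n. E n)"
    unfolding negligible_iff_null_sets by (rule AE_not_in)
  then have "AE t in lborel. t \<notin> (\<Union>n. E n)"
    unfolding AE_completion_iff .
  then show ?thesis
  proof (rule AE_mp, intro AE_I2 impI)
    fix t assume t: "t \<notin> (\<Union>n. E n)" "t \<in> {a<..<b}"
    have comb: "integral {a..s} f - integral {a..r} f = integral {r..s} f"
      if "a \<le> r" "r \<le> s" "s \<le> b" for r s
      using Henstock_Kurzweil_Integration.integral_combine[OF that(1,2) integrable_on_subinterval[OF f]] that by (metis add_diff_cancel_left' atLeastatMost_subset_iff order_refl)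
    show "((\<lambda>s. integral {a..s} f) has_vector_derivative f t) (at t)"
      unfolding has_vector_derivative_def has_derivative_within_alt
    proof (intro conjI allI impI)
      show "bounded_linear (\<lambda>x. x *\<^sub>R f t)" by (rule bounded_linear_scaleR_left)
      fix e :: real assume "e > 0"
      then obtain n where n: "inverse (Suc n) < e" using reals_Archimedean by auto
      from t(1) have "t \<notin> E n" by auto
      then obtain d where "d > 0" and d: "\<And>u v. a \<le> u \<Longrightarrow> u \<le> t \<Longrightarrow> t \<le> v \<Longrightarrow> v \<le> b \<Longrightarrow> u < v \<Longrightarrow> v - u < d \<Longrightarrow>
           norm ((v - u) *\<^sub>R f t - integral {u..v} f) < inverse (Suc n) * (v - u)"
        unfolding E_def by (force simp: not_le)
      \<comment> \<open>The extra terms keep \<open>y\<close> inside \<open>{a..b}\<close>, where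
        integrals can be combined.\<close>
      define d' where "d' = min d (min (t - a) (b - t))"
      have "d' > 0" using \<open>d > 0\<close> t by (auto simp: d'_def)
      moreover have "norm (integral {a..y} f - integral {a..t} f - (y - t) *\<^sub>R f t) \<le> e * norm (y - t)"
        if "norm (y - t) < d'" for y
      proof (cases y t rule: linorder_cases)
        case greater
        then have "norm ((y - t) *\<^sub>R f t - integral {t..y} f) \<le> inverse (Suc n) * (y - t)"
          using d[of t y] that t by (auto simp: d'_def)
        also have "\<dots> \<le> e * (y - t)"
          using n greater by (intro mult_right_mono) auto
        finally show ?thesis
          using comb[of t y] that t greater by (simp add: d'_def norm_minus_commute)
      next
        case less
        then have "norm ((t - y) *\<^sub>R f t - integral {y..t} f) \<le> inverse (Suc n) * (t - y)"
          using d[of y t] that t by (auto simp: d'_def)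
        also have "\<dots> \<le> e * (t - y)"
          using n less by (intro mult_right_mono) auto
        finally have "norm ((t - y) *\<^sub>R f t - (integral {a..t} f - integral {a..y} f)) \<le> e * norm (y - t)"
          using comb[of y t] that t less by (simp add: d'_def)
        moreover have "integral {a..y} f - integral {a..t} f - (y - t) *\<^sub>R f t
                   = (t - y) *\<^sub>R f t - (integral {a..t} f - integral {a..y} f)"
          by (simp add: algebra_simps)
        ultimately show ?thesis by (simp only:)
      qed auto
      ultimately show "\<exists>d>0. \<forall>y\<in>UNIV. norm (y - t) < d \<longrightarrow>
          norm (integral {a..y} f - integral {a..t} f - (y - t) *\<^sub>R f t) \<le> e * norm (y - t)"
        by blast
    qed
  qed
qed

section \<open>Absolutely continuous functions\<close>

lemma AE_lborel_iff_negligible: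
  "(AE t in lborel. P t) \<longleftrightarrow> negligible {t::'a::euclidean_space. \<not> P t}"
  unfolding AE_completion_iff[of _ lborel, symmetric] completion.AE_iff_null_sets negligible_iff_null_sets by simp

lemma real_division_ofE:
  assumes "D division_of S" "k \<in> D"
  obtains u v :: real where "u \<le> v" "k = {u..v}" "Inf k = u" "Sup k = v"
proof -
  obtain u v where "k = cbox u v" "k \<noteq> {}"
    using division_ofD(3,4)[OF assms(1)] assms(2) by metis
  then show thesis using that[of u v] by auto
qed

lemma abs_continuous_on_cboxD:
  assumes "abs_continuous_on_cbox a b f" "\<epsilon> > 0"
  shows "\<exists>\<delta>>0. \<forall>D. D division_of \<Union>D \<longrightarrow> \<Union>D \<subseteq> {a..b} \<longrightarrow>
        (\<Sum>k\<in>D. Sup k - Inf k) < \<delta> \<longrightarrow> (\<Sum>k\<in>D. norm (f (Sup k) - f (Inf k))) < \<epsilon>"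
  using assms(1)[unfolded abs_continuous_on_cbox_def, rule_format, OF assms(2)] .

lemma abs_continuous_on_cbox_cong:
  assumes f: "abs_continuous_on_cbox a b f" and eq: "\<And>t. t \<in> {a..b} \<Longrightarrow> f t = g t"
  shows "abs_continuous_on_cbox a b g"
  unfolding abs_continuous_on_cbox_def
proof (intro allI impI)
  fix \<epsilon> :: real assume "\<epsilon> > 0"
  obtain \<delta> where "\<delta> > 0" and \<delta>: "\<forall>D. D division_of \<Union>D \<longrightarrow> \<Union>D \<subseteq> {a..b} \<longrightarrow>
        (\<Sum>k\<in>D. Sup k - Inf k) < \<delta> \<longrightarrow> (\<Sum>k\<in>D. norm (f (Sup k) - f (Inf k))) < \<epsilon>"
    using abs_continuous_on_cboxD[OF f \<open>\<epsilon> > 0\<close>] by (elim exE conjE)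
  have "(\<Sum>k\<in>D. norm (g (Sup k) - g (Inf k))) < \<epsilon>"
    if D: "D division_of \<Union>D" "\<Union>D \<subseteq> {a..b}" "(\<Sum>k\<in>D. Sup k - Inf k) < \<delta>" for D
  proof -
    have "f (Sup k) = g (Sup k) \<and> f (Inf k) = g (Inf k)" if "k \<in> D" for k
    proof -
      obtain u v where uv: "u \<le> v" "k = {u..v}" "Inf k = u" "Sup k = v"
        using real_division_ofE[OF D(1) \<open>k \<in> D\<close>] .
      have "k \<subseteq> {a..b}" using D(2) that by blast
      then show ?thesis using uv by (auto intro!: eq)
    qed
    then show ?thesis using \<delta>[rule_format, OF D] by (simp cong: sum.cong)
  qed
  with \<open>\<delta> > 0\<close> show "\<exists>\<delta>>0. \<forall>D. D division_of \<Union>D \<longrightarrow> \<Union>D \<subseteq> {a..b} \<longrightarrow>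
        (\<Sum>k\<in>D. Sup k - Inf k) < \<delta> \<longrightarrow> (\<Sum>k\<in>D. norm (g (Sup k) - g (Inf k))) < \<epsilon>"
    by blast
qed

lemma abs_continuous_on_cbox_add:
  assumes f: "abs_continuous_on_cbox a b f" and g: "abs_continuous_on_cbox a b g"
  shows "abs_continuous_on_cbox a b (\<lambda>t. f t + g t)"
  unfolding abs_continuous_on_cbox_def
proof (intro allI impI)
  fix \<epsilon> :: real assume "\<epsilon> > 0"
  then have "\<epsilon> / 2 > 0" by simp
  obtain \<delta>1 where "\<delta>1 > 0" and \<delta>1: "\<forall>D. D division_of \<Union>D \<longrightarrow> \<Union>D \<subseteq> {a..b} \<longrightarrow>
        (\<Sum>k\<in>D. Sup k - Inf k) < \<delta>1 \<longrightarrow> (\<Sum>k\<in>D. norm (f (Sup k) - f (Inf k))) < \<epsilon> / 2"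
    using abs_continuous_on_cboxD[OF f \<open>\<epsilon> / 2 > 0\<close>] by (elim exE conjE)
  obtain \<delta>2 where "\<delta>2 > 0" and \<delta>2: "\<forall>D. D division_of \<Union>D \<longrightarrow> \<Union>D \<subseteq> {a..b} \<longrightarrow>
        (\<Sum>k\<in>D. Sup k - Inf k) < \<delta>2 \<longrightarrow> (\<Sum>k\<in>D. norm (g (Sup k) - g (Inf k))) < \<epsilon> / 2"
    using abs_continuous_on_cboxD[OF g \<open>\<epsilon> / 2 > 0\<close>] by (elim exE conjE)
  have "(\<Sum>k\<in>D. norm (f (Sup k) + g (Sup k) - (f (Inf k) + g (Inf k)))) < \<epsilon>"
    if D: "D division_of \<Union>D" "\<Union>D \<subseteq> {a..b}" "(\<Sum>k\<in>D. Sup k - Inf k) < min \<delta>1 \<delta>2" for D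
  proof -
    have "(\<Sum>k\<in>D. norm (f (Sup k) + g (Sup k) - (f (Inf k) + g (Inf k))))
        \<le> (\<Sum>k\<in>D. norm (f (Sup k) - f (Inf k)) + norm (g (Sup k) - g (Inf k)))"
      by (intro sum_mono norm_diff_triangle_ineq)
    also have "\<dots> < \<epsilon>"
      using \<delta>1[rule_format, OF D(1,2)] \<delta>2[rule_format, OF D(1,2)] D(3) by (simp add: sum.distrib)
    finally show ?thesis .
  qed
  moreover have "min \<delta>1 \<delta>2 > 0" using \<open>\<delta>1 > 0\<close> \<open>\<delta>2 > 0\<close> by simp
  ultimately show "\<exists>\<delta>>0. \<forall>D. D division_of \<Union>D \<longrightarrow> \<Union>D \<subseteq> {a..b} \<longrightarrow>
        (\<Sum>k\<in>D. Sup k - Inf k) < \<delta> \<longrightarrow>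
        (\<Sum>k\<in>D. norm (f (Sup k) + g (Sup k) - (f (Inf k) + g (Inf k)))) < \<epsilon>"
    by blast
qed

lemma abs_continuous_on_cbox_lipschitz:
  assumes "\<And>s t. a \<le> s \<Longrightarrow> s \<le> t \<Longrightarrow> t \<le> b \<Longrightarrow> norm (f t - f s) \<le> M * (t - s)"
  shows "abs_continuous_on_cbox a b f"
  unfolding abs_continuous_on_cbox_def
proof (intro allI impI exI conjI)
  fix \<epsilon> :: real assume "\<epsilon> > 0"
  \<comment> \<open>\<open>M\<close> may be zero or negative; the absolute value and the added 1
    keep the denominator positive.\<close>
  show "\<epsilon> / (\<bar>M\<bar> + 1) > 0" using \<open>\<epsilon> > 0\<close> by simp
  fix D assume D: "D division_of \<Union>D" "\<Union>D \<subseteq> {a..b}" "(\<Sum>k\<in>D. Sup k - Inf k) < \<epsilon> / (\<bar>M\<bar> + 1)"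
  have "(\<Sum>k\<in>D. norm (f (Sup k) - f (Inf k))) \<le> (\<Sum>k\<in>D. (\<bar>M\<bar> + 1) * (Sup k - Inf k))"
  proof (rule sum_mono)
    fix k assume "k \<in> D"
    then obtain u v where uv: "u \<le> v" "k = {u..v}" "Inf k = u" "Sup k = v"
      using real_division_ofE[OF D(1)] by blast
    have "k \<subseteq> {a..b}" using D(2) \<open>k \<in> D\<close> by blast
    then have "norm (f v - f u) \<le> M * (v - u)" using uv by (intro assms) auto
    also have "\<dots> \<le> (\<bar>M\<bar> + 1) * (v - u)" using uv by (intro mult_right_mono) auto
    finally show "norm (f (Sup k) - f (Inf k)) \<le> (\<bar>M\<bar> + 1) * (Sup k - Inf k)"
      unfolding uv(3,4) .
  qed
  also have "\<dots> = (\<bar>M\<bar> + 1) * (\<Sum>k\<in>D. Sup k - Inf k)" by (simp add: sum_distrib_left)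
  also have "\<dots> < \<epsilon>" using D(3) by (simp add: pos_less_divide_eq mult.commute)
  finally show "(\<Sum>k\<in>D. norm (f (Sup k) - f (Inf k))) < \<epsilon>" .
qed

lemma abs_continuous_on_cbox_imp_continuous_on:
  assumes "abs_continuous_on_cbox a b f"
  shows "continuous_on {a..b} f"
  unfolding continuous_on_iff
proof (intro ballI allI impI)
  fix x \<epsilon> :: real assume x: "x \<in> {a..b}" and "\<epsilon> > 0"
  obtain \<delta> where "\<delta> > 0" and \<delta>: "\<forall>D. D division_of \<Union>D \<longrightarrow> \<Union>D \<subseteq> {a..b} \<longrightarrow>
        (\<Sum>k\<in>D. Sup k - Inf k) < \<delta> \<longrightarrow> (\<Sum>k\<in>D. norm (f (Sup k) - f (Inf k))) < \<epsilon>"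
    using abs_continuous_on_cboxD[OF assms \<open>\<epsilon> > 0\<close>] by (elim exE conjE)
  have bnd: "norm (f v - f u) < \<epsilon>" if "u \<le> v" "u \<in> {a..b}" "v \<in> {a..b}" "v - u < \<delta>" for u v
  proof -
    have "{{u..v}} division_of \<Union>{{u..v}}"
      using division_of_self[of u v] that by simp
    then show ?thesis using \<delta>[rule_format, of "{{u..v}}"] that by simp
  qed
  have "dist (f y) (f x) < \<epsilon>" if "y \<in> {a..b}" "dist y x < \<delta>" for y
    using bnd[of x y] bnd[of y x] that x
    by (cases "y \<le> x") (simp_all add: dist_norm norm_minus_commute)
  then show "\<exists>d>0. \<forall>x'\<in>{a..b}. dist x' x < d \<longrightarrow> dist (f x') (f x) < \<epsilon>"
    using \<open>\<delta> > 0\<close> by blast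
qed

text \<open>Clamping continues \<open>f\<close> by constants beyond \<open>{c..d}\<close>. A
  division of the larger interval is clipped to \<open>{c..d}\<close>: this does not increase the
  total length, and the parts cut off carry no variation.\<close>

lemma abs_continuous_on_cbox_clamp:
  assumes f: "abs_continuous_on_cbox c d f" and "c \<le> d"
  shows "abs_continuous_on_cbox a b (\<lambda>t. f (max c (min d t)))"
  unfolding abs_continuous_on_cbox_def
proof (intro allI impI)
  fix \<epsilon> :: real assume "\<epsilon> > 0"
  obtain \<delta> where "\<delta> > 0" and \<delta>: "\<forall>D. D division_of \<Union>D \<longrightarrow> \<Union>D \<subseteq> {c..d} \<longrightarrow>
        (\<Sum>k\<in>D. Sup k - Inf k) < \<delta> \<longrightarrow> (\<Sum>k\<in>D. norm (f (Sup k) - f (Inf k))) < \<epsilon>"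
    using abs_continuous_on_cboxD[OF f \<open>\<epsilon> > 0\<close>] by (elim exE conjE)
  have "(\<Sum>k\<in>D. norm (f (max c (min d (Sup k))) - f (max c (min d (Inf k))))) < \<epsilon>"
    if D: "D division_of \<Union>D" "(\<Sum>k\<in>D. Sup k - Inf k) < \<delta>" for D
  proof -
    \<comment> \<open>Intervals failing this test have both endpoints clamped to the same point and
      contribute 0. The strict inequality leaves clipped intervals with nonempty interior, which
      makes \<open>h\<close> injective.\<close>
    define D' where "D' = {k \<in> D. max c (Inf k) < min d (Sup k)}"
    define h where "h k = {max c (Inf k)..min d (Sup k)}" for k :: "real set"
    have "finite D" using D(1) by (rule division_of_finite)
    then have "finite D'" "D' \<subseteq> D" by (auto simp: D'_def)
    have int_h: "interior (h k) \<noteq> {}" "interior (h k) \<subseteq> interior k" if k: "k \<in> D'" for k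
    proof -
      obtain u v where uv: "u \<le> v" "k = {u..v}" "Inf k = u" "Sup k = v"
        using real_division_ofE[OF D(1)] k by (auto simp: D'_def)
      show "interior (h k) \<subseteq> interior k"
        by (rule interior_mono) (auto simp: h_def uv)
      show "interior (h k) \<noteq> {}"
        using k unfolding D'_def h_def interior_atLeastAtMost_real greaterThanLessThan_empty_iff
        by (simp only: mem_Collect_eq not_le simp_thms)
    qed
    have disj: "interior (h k) \<inter> interior (h l) = {}" if "k \<in> D'" "l \<in> D'" "k \<noteq> l" for k l
      using division_ofD(5)[OF D(1), of k l] int_h(2)[of k] int_h(2)[of l] that \<open>D' \<subseteq> D\<close> by blast
    have inj: "inj_on h D'"
    proof (rule inj_onI, rule ccontr)
      fix k l assume kl: "k \<in> D'" "l \<in> D'" "h k = h l" "k \<noteq> l"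
      then show False using disj[of k l] int_h(1)[of k] by simp
    qed
    have Sup_h: "Sup (h k) = min d (Sup k)" "Inf (h k) = max c (Inf k)" if "k \<in> D'" for k
      using that unfolding h_def D'_def by (simp_all add: cSup_atLeastAtMost cInf_atLeastAtMost)
    have "(h ` D') division_of \<Union>(h ` D')"
      unfolding division_of_def
    proof (intro conjI ballI impI)
      show "finite (h ` D')" using \<open>finite D'\<close> by simp
      fix K assume K: "K \<in> h ` D'"
      then show "K \<subseteq> \<Union>(h ` D')" "K \<noteq> {}" "\<exists>a b. K = cbox a b"
        using int_h by (auto simp: h_def D'_def)
      fix K2 assume "K2 \<in> h ` D'" "K \<noteq> K2"
      then show "interior K \<inter> interior K2 = {}"
        using K disj by (metis imageE)
    qed simp
    moreover have "\<Union>(h ` D') \<subseteq> {c..d}" by (auto simp: h_def)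
    moreover have "(\<Sum>k\<in>h ` D'. Sup k - Inf k) < \<delta>"
    proof -
      have "(\<Sum>k\<in>h ` D'. Sup k - Inf k) = (\<Sum>k\<in>D'. min d (Sup k) - max c (Inf k))"
        by (simp add: sum.reindex[OF inj] Sup_h cong: sum.cong)
      also have "\<dots> \<le> (\<Sum>k\<in>D'. Sup k - Inf k)"
        by (intro sum_mono) auto
      also have "\<dots> \<le> (\<Sum>k\<in>D. Sup k - Inf k)"
      proof (rule sum_mono2[OF \<open>finite D\<close> \<open>D' \<subseteq> D\<close>])
        fix k assume "k \<in> D - D'"
        then obtain u v where "u \<le> v" "k = {u..v}" "Inf k = u" "Sup k = v"
          using real_division_ofE[OF D(1)] by blast
        then show "0 \<le> Sup k - Inf k" by simp
      qed
      finally show ?thesis using D(2) by simp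
    qed
    ultimately have "(\<Sum>k\<in>h ` D'. norm (f (Sup k) - f (Inf k))) < \<epsilon>" by (rule \<delta>[rule_format])
    then have "(\<Sum>k\<in>D'. norm (f (min d (Sup k)) - f (max c (Inf k)))) < \<epsilon>"
      by (simp add: sum.reindex[OF inj] Sup_h cong: sum.cong)
    also have "(\<Sum>k\<in>D'. norm (f (min d (Sup k)) - f (max c (Inf k)))) =
         (\<Sum>k\<in>D. norm (f (max c (min d (Sup k))) - f (max c (min d (Inf k)))))"
    proof (rule sum.mono_neutral_cong_left[OF \<open>finite D\<close> \<open>D' \<subseteq> D\<close>])
      show "\<forall>k\<in>D - D'. norm (f (max c (min d (Sup k))) - f (max c (min d (Inf k)))) = 0"
      proof
        fix k assume k: "k \<in> D - D'"
        then obtain u v where uv: "u \<le> v" "k = {u..v}" "Inf k = u" "Sup k = v"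
          using real_division_ofE[OF D(1)] by blast
        then have "min d v \<le> max c u" using k by (auto simp: D'_def)
        then have "max c (min d v) = max c (min d u)"
          using \<open>u \<le> v\<close> \<open>c \<le> d\<close> by linarith
        then show "norm (f (max c (min d (Sup k))) - f (max c (min d (Inf k)))) = 0"
          using uv by simp
      qed
      fix k assume k: "k \<in> D'"
      then obtain u v where uv: "u \<le> v" "k = {u..v}" "Inf k = u" "Sup k = v"
        using real_division_ofE[OF D(1)] by (auto simp: D'_def)
      then have "max c u < min d v" using k by (auto simp: D'_def)
      then have "max c (min d v) = min d v" "max c (min d u) = max c u" by linarith+
      then show "norm (f (min d (Sup k)) - f (max c (Inf k))) =
          norm (f (max c (min d (Sup k))) - f (max c (min d (Inf k))))"
        using uv by simp
    qed
    finally show ?thesis .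
  qed
  then show "\<exists>\<delta>>0. \<forall>D. D division_of \<Union>D \<longrightarrow> \<Union>D \<subseteq> {a..b} \<longrightarrow> (\<Sum>k\<in>D. Sup k - Inf k) < \<delta> \<longrightarrow>
     (\<Sum>k\<in>D. norm (f (max c (min d (Sup k))) - f (max c (min d (Inf k))))) < \<epsilon>"
    using \<open>\<delta> > 0\<close> by blast
qed

text \<open>On \<open>{a..b}\<close> the function is the sum of its two clamped pieces minus
  \<open>f c\<close>. Thus no division has to be split at \<open>c\<close>.\<close>

lemma abs_continuous_on_cbox_combine:
  assumes f1: "abs_continuous_on_cbox a c f" and f2: "abs_continuous_on_cbox c b f"
    and "a \<le> c" "c \<le> b"
  shows "abs_continuous_on_cbox a b f"
proof -
  have "abs_continuous_on_cbox a b (\<lambda>t. f (max a (min c t)) + f (max c (min b t)) + - f c)"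
    by (rule abs_continuous_on_cbox_add[OF abs_continuous_on_cbox_add
          [OF abs_continuous_on_cbox_clamp[OF f1 assms(3)] abs_continuous_on_cbox_clamp[OF f2 assms(4)]]
        abs_continuous_on_cbox_lipschitz[where M = 0]]) simp
  then show ?thesis
  proof (rule abs_continuous_on_cbox_cong)
    fix t assume t: "t \<in> {a..b}"
    show "f (max a (min c t)) + f (max c (min b t)) + - f c = f t"
    proof (cases "t \<le> c")
      case True
      then have "max a (min c t) = t" "max c (min b t) = c" using t \<open>c \<le> b\<close> by auto
      then show ?thesis by simp
    next
      case False
      then have "max a (min c t) = c" "max c (min b t) = t" using t \<open>a \<le> c\<close> by auto
      then show ?thesis by simp
    qed
  qed
qed

lemma abs_continuous_on_cbox_reflect:
  assumes f: "abs_continuous_on_cbox a b f"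
  shows "abs_continuous_on_cbox (c - b) (c - a) (\<lambda>t. f (c - t))"
  unfolding abs_continuous_on_cbox_def
proof (intro allI impI)
  fix \<epsilon> :: real assume "\<epsilon> > 0"
  obtain \<delta> where "\<delta> > 0" and \<delta>: "\<forall>D. D division_of \<Union>D \<longrightarrow> \<Union>D \<subseteq> {a..b} \<longrightarrow>
        (\<Sum>k\<in>D. Sup k - Inf k) < \<delta> \<longrightarrow> (\<Sum>k\<in>D. norm (f (Sup k) - f (Inf k))) < \<epsilon>"
    using abs_continuous_on_cboxD[OF f \<open>\<epsilon> > 0\<close>] by (elim exE conjE)
  have "(\<Sum>k\<in>D. norm (f (c - Sup k) - f (c - Inf k))) < \<epsilon>"
    if D: "D division_of \<Union>D" "\<Union>D \<subseteq> {c - b..c - a}" "(\<Sum>k\<in>D. Sup k - Inf k) < \<delta>" for D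
  proof -
    define h where "h k = {t. c - t \<in> k}" for k :: "real set"
    have inv: "h (h k) = k" for k by (simp add: h_def)
    then have inj: "inj_on h D" by (metis inj_on_inverseI)
    have h_ivl: "h {u..v} = {c - v..c - u}" for u v by (auto simp: h_def)
    have Sup_h: "Sup (h k) = c - Inf k" "Inf (h k) = c - Sup k" if k: "k \<in> D" for k
    proof -
      obtain u v where "u \<le> v" "k = {u..v}" "Inf k = u" "Sup k = v"
        using real_division_ofE[OF D(1) k] .
      then show "Sup (h k) = c - Inf k" "Inf (h k) = c - Sup k"
        by (simp_all add: h_ivl cSup_atLeastAtMost cInf_atLeastAtMost)
    qed
    have int_h: "interior (h k) = h (interior k)" if k: "k \<in> D" for k
    proof -
      obtain u v where "u \<le> v" "k = {u..v}" "Inf k = u" "Sup k = v"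
        using real_division_ofE[OF D(1) k] .
      then show ?thesis
        by (simp add: h_ivl interior_atLeastAtMost_real) (auto simp: h_def)
    qed
    have "(h ` D) division_of \<Union>(h ` D)"
      unfolding division_of_def
    proof (intro conjI ballI impI)
      show "finite (h ` D)" using division_of_finite[OF D(1)] by simp
      fix K assume K: "K \<in> h ` D"
      then obtain k where k: "k \<in> D" "K = h k" by blast
      obtain u v where uv: "u \<le> v" "k = {u..v}"
        using real_division_ofE[OF D(1) k(1)] by metis
      show "K \<subseteq> \<Union>(h ` D)" using K by blast
      show "K \<noteq> {}" using k uv by (simp add: h_ivl)
      show "\<exists>a b. K = cbox a b" using k uv h_ivl by (metis cbox_interval)
      fix K2 assume "K2 \<in> h ` D" and ne: "K \<noteq> K2"
      then obtain l where l: "l \<in> D" "K2 = h l" by blast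
      then have "interior k \<inter> interior l = {}"
        using division_ofD(5)[OF D(1) k(1) l(1)] k ne by blast
      then show "interior K \<inter> interior K2 = {}"
        unfolding k(2) l(2) int_h[OF k(1)] int_h[OF l(1)] unfolding h_def by auto
    qed simp
    moreover have "\<Union>(h ` D) \<subseteq> {a..b}"
      using D(2) by (force simp: h_def)
    moreover have "(\<Sum>k\<in>h ` D. Sup k - Inf k) < \<delta>"
      using D(3) by (simp add: sum.reindex[OF inj] Sup_h cong: sum.cong)
    ultimately have "(\<Sum>k\<in>h ` D. norm (f (Sup k) - f (Inf k))) < \<epsilon>" by (rule \<delta>[rule_format])
    then show ?thesis
      by (simp add: sum.reindex[OF inj] Sup_h norm_minus_commute cong: sum.cong)
  qed
  with \<open>\<delta> > 0\<close> show "\<exists>\<delta>>0. \<forall>D. D division_of \<Union>D \<longrightarrow> \<Union>D \<subseteq> {c - b..c - a} \<longrightarrow>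
        (\<Sum>k\<in>D. Sup k - Inf k) < \<delta> \<longrightarrow> (\<Sum>k\<in>D. norm (f (c - Sup k) - f (c - Inf k))) < \<epsilon>"
    by blast
qed

section \<open>Solutions and reachability\<close>

lemma is_interval_atLeastAtMost_subset:
  fixes I :: "real set"
  assumes "is_interval I" "a \<in> I" "b \<in> I"
  shows "{a..b} \<subseteq> I"
  using assms unfolding is_interval_1 by (meson atLeastAtMost_iff subsetI)

lemma AE_interior_of_interval:
  fixes I :: "real set"
  assumes "is_interval I"
  shows "AE t in lborel. t \<in> I \<longrightarrow> t \<in> interior I"
proof -
  have "negligible (frontier I)"
    using assms by (intro negligible_convex_frontier is_interval_convex)
  then show ?thesis
    unfolding AE_lborel_iff_negligible
    by (rule negligible_subset) (use closure_subset in \<open>auto simp: frontier_def\<close>)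
qed

text \<open>The endpoints of an interval form a null set. On the interior the derivative is
  two-sided and no longer refers to \<open>I\<close>, which makes restriction and gluing
  easy.\<close>

lemma di_solution_iff_interior:
  "di_solution U F I \<phi> \<longleftrightarrow> is_interval I \<and> \<phi> ` I \<subseteq> U \<and> abs_continuous_on I \<phi> \<and>
     (AE t in lborel. t \<in> interior I \<longrightarrow> (\<exists>v \<in> F (\<phi> t). (\<phi> has_vector_derivative v) (at t)))"
proof -
  have "(AE t in lborel. t \<in> I \<longrightarrow> (\<exists>v \<in> F (\<phi> t). (\<phi> has_vector_derivative v) (at t within I))) \<longleftrightarrow>
     (AE t in lborel. t \<in> interior I \<longrightarrow> (\<exists>v \<in> F (\<phi> t). (\<phi> has_vector_derivative v) (at t)))"
    if I: "is_interval I"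
  proof
    assume "AE t in lborel. t \<in> I \<longrightarrow> (\<exists>v \<in> F (\<phi> t). (\<phi> has_vector_derivative v) (at t within I))"
    then show "AE t in lborel. t \<in> interior I \<longrightarrow> (\<exists>v \<in> F (\<phi> t). (\<phi> has_vector_derivative v) (at t))"
    proof (rule AE_mp, intro AE_I2 impI)
      fix t assume *: "t \<in> I \<longrightarrow> (\<exists>v \<in> F (\<phi> t). (\<phi> has_vector_derivative v) (at t within I))" and t: "t \<in> interior I"
      then show "\<exists>v \<in> F (\<phi> t). (\<phi> has_vector_derivative v) (at t)"
        using interior_subset at_within_interior[OF t] by auto
    qed
  next
    assume *: "AE t in lborel. t \<in> interior I \<longrightarrow> (\<exists>v \<in> F (\<phi> t). (\<phi> has_vector_derivative v) (at t))"
    show "AE t in lborel. t \<in> I \<longrightarrow> (\<exists>v \<in> F (\<phi> t). (\<phi> has_vector_derivative v) (at t within I))"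
      using * AE_interior_of_interval[OF I]
    proof eventually_elim
      case (elim t)
      then show ?case by (meson has_vector_derivative_at_within)
    qed
  qed
  then show ?thesis unfolding di_solution_def by blast
qed

lemma di_solution_subset:
  assumes "di_solution U F I \<phi>" "J \<subseteq> I" "is_interval J"
  shows "di_solution U F J \<phi>"
proof -
  have *: "\<phi> ` I \<subseteq> U" "abs_continuous_on I \<phi>"
    "AE t in lborel. t \<in> interior I \<longrightarrow> (\<exists>v \<in> F (\<phi> t). (\<phi> has_vector_derivative v) (at t))"
    using assms(1) unfolding di_solution_iff_interior by blast+
  have "abs_continuous_on J \<phi>"
    using *(2) assms(2) unfolding abs_continuous_on_def by (meson order_trans)
  moreover have "AE t in lborel. t \<in> interior J \<longrightarrow> (\<exists>v \<in> F (\<phi> t). (\<phi> has_vector_derivative v) (at t))"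
    using *(3)
  proof eventually_elim
    case (elim t)
    then show ?case using interior_mono[OF assms(2)] by blast
  qed
  ultimately show ?thesis
    unfolding di_solution_iff_interior using assms *(1) by blast
qed

lemma di_solution_cong:
  assumes sol: "di_solution U F I \<phi>" and eq: "\<And>t. t \<in> I \<Longrightarrow> \<phi> t = \<psi> t"
  shows "di_solution U F I \<psi>"
proof -
  have *: "is_interval I" "\<phi> ` I \<subseteq> U" "abs_continuous_on I \<phi>"
    "AE t in lborel. t \<in> interior I \<longrightarrow> (\<exists>v \<in> F (\<phi> t). (\<phi> has_vector_derivative v) (at t))"
    using sol unfolding di_solution_iff_interior by blast+
  have "abs_continuous_on I \<psi>"
    unfolding abs_continuous_on_def
  proof (intro allI impI)
    fix a b :: real assume ab: "a \<le> b" "{a..b} \<subseteq> I"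
    then have "abs_continuous_on_cbox a b \<phi>" using *(3) by (simp add: abs_continuous_on_def)
    then show "abs_continuous_on_cbox a b \<psi>"
      by (rule abs_continuous_on_cbox_cong) (use ab eq in blast)
  qed
  moreover have "AE t in lborel. t \<in> interior I \<longrightarrow> (\<exists>v \<in> F (\<psi> t). (\<psi> has_vector_derivative v) (at t))"
    using *(4)
  proof (rule AE_mp, intro AE_I2 impI)
    fix t assume t: "t \<in> interior I" and "t \<in> interior I \<longrightarrow> (\<exists>v \<in> F (\<phi> t). (\<phi> has_vector_derivative v) (at t))"
    then obtain v where v: "v \<in> F (\<phi> t)" "(\<phi> has_vector_derivative v) (at t)" by blast
    have "\<phi> t = \<psi> t" using t interior_subset eq by blast
    moreover have "(\<psi> has_vector_derivative v) (at t)"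
      by (rule has_vector_derivative_transform_within_open[OF v(2) open_interior t])
         (use interior_subset eq in blast)
    ultimately show "\<exists>v \<in> F (\<psi> t). (\<psi> has_vector_derivative v) (at t)" using v by auto
  qed
  moreover have "\<psi> ` I \<subseteq> U" using *(2) eq by auto
  ultimately show ?thesis
    unfolding di_solution_iff_interior using * by blast
qed

text \<open>A compact subinterval of the union either has both endpoints in one of the intervals or
  can be cut at the common point \<open>c\<close> into two such pieces. For the derivative, almost
  every point of the union is interior to \<open>I\<close> or to \<open>J\<close>.\<close>

lemma di_solution_Un:
  assumes sol: "di_solution U F I \<phi>" "di_solution U F J \<phi>" and c: "c \<in> I" "c \<in> J"
  shows "di_solution U F (I \<union> J) \<phi>"
proof -
  have I: "is_interval I" "\<phi> ` I \<subseteq> U" "abs_continuous_on I \<phi>"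
    "AE t in lborel. t \<in> interior I \<longrightarrow> (\<exists>v \<in> F (\<phi> t). (\<phi> has_vector_derivative v) (at t))"
    using sol(1) unfolding di_solution_iff_interior by blast+
  have J: "is_interval J" "\<phi> ` J \<subseteq> U" "abs_continuous_on J \<phi>"
    "AE t in lborel. t \<in> interior J \<longrightarrow> (\<exists>v \<in> F (\<phi> t). (\<phi> has_vector_derivative v) (at t))"
    using sol(2) unfolding di_solution_iff_interior by blast+
  have "connected (I \<union> J)"
    using I(1) J(1) c by (intro connected_Un) (auto simp: is_interval_connected_1)
  then have "is_interval (I \<union> J)" by (simp add: is_interval_connected_1)
  moreover have "abs_continuous_on (I \<union> J) \<phi>"
    unfolding abs_continuous_on_def
  proof (intro allI impI)
    fix a b :: real assume ab: "a \<le> b" "{a..b} \<subseteq> I \<union> J"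
    have one: "abs_continuous_on_cbox u v \<phi>" if "u \<le> v" "u \<in> I \<and> v \<in> I \<or> u \<in> J \<and> v \<in> J" for u v
      using that(2)
    proof
      assume "u \<in> I \<and> v \<in> I"
      then have "{u..v} \<subseteq> I" using is_interval_atLeastAtMost_subset[OF I(1)] by simp
      then show ?thesis using I(3) \<open>u \<le> v\<close> by (simp add: abs_continuous_on_def)
    next
      assume "u \<in> J \<and> v \<in> J"
      then have "{u..v} \<subseteq> J" using is_interval_atLeastAtMost_subset[OF J(1)] by simp
      then show ?thesis using J(3) \<open>u \<le> v\<close> by (simp add: abs_continuous_on_def)
    qed
    note sub = is_interval_atLeastAtMost_subset
    have "a \<in> I \<union> J" "b \<in> I \<union> J" using ab by auto
    consider "c \<le> a" | "a \<le> c" "c \<le> b" | "b \<le> c" by linarith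
    then show "abs_continuous_on_cbox a b \<phi>"
    proof cases
      case 1
      then have "a \<in> {c..b}" using ab by simp
      then have "a \<in> I \<and> b \<in> I \<or> a \<in> J \<and> b \<in> J"
        using \<open>b \<in> I \<union> J\<close> sub[OF I(1) c(1), of b] sub[OF J(1) c(2), of b] by blast
      then show ?thesis using one ab by blast
    next
      case 2
      have "abs_continuous_on_cbox a c \<phi>" "abs_continuous_on_cbox c b \<phi>"
        using one 2 c \<open>a \<in> I \<union> J\<close> \<open>b \<in> I \<union> J\<close> by blast+
      then show ?thesis using 2 by (rule abs_continuous_on_cbox_combine)
    next
      case 3
      then have "b \<in> {a..c}" using ab by simp
      then have "a \<in> I \<and> b \<in> I \<or> a \<in> J \<and> b \<in> J"
        using \<open>a \<in> I \<union> J\<close> sub[OF I(1) _ c(1), of a] sub[OF J(1) _ c(2), of a] by blast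
      then show ?thesis using one ab by blast
    qed
  qed
  moreover have "AE t in lborel. t \<in> interior (I \<union> J) \<longrightarrow> (\<exists>v \<in> F (\<phi> t). (\<phi> has_vector_derivative v) (at t))"
    using I(4) J(4) AE_interior_of_interval[OF I(1)] AE_interior_of_interval[OF J(1)]
  proof eventually_elim
    case (elim t)
    then show ?case using interior_subset[of "I \<union> J"] by blast
  qed
  ultimately show ?thesis
    unfolding di_solution_iff_interior using I(2) J(2) by blast
qed

text \<open>Serves for unions of chains of solutions. The exceptional null set depends on the
  compact subinterval, so the derivative condition is collected from countably many of them.\<close>

lemma di_solution_if_compact:
  assumes J: "is_interval J"
    and sol: "\<And>a b. a \<le> b \<Longrightarrow> {a..b} \<subseteq> J \<Longrightarrow> di_solution U F {a..b} \<phi>"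
  shows "di_solution U F J \<phi>"
proof -
  have *: "\<phi> ` {a..b} \<subseteq> U" "abs_continuous_on {a..b} \<phi>"
    "AE t in lborel. t \<in> {a<..<b} \<longrightarrow> (\<exists>v \<in> F (\<phi> t). (\<phi> has_vector_derivative v) (at t))"
    if "a \<le> b" "{a..b} \<subseteq> J" for a b
    using sol[OF that] unfolding di_solution_iff_interior interior_atLeastAtMost_real by blast+
  have "\<phi> ` J \<subseteq> U"
  proof
    fix y assume "y \<in> \<phi> ` J"
    then obtain t where "t \<in> J" "y = \<phi> t" by blast
    then show "y \<in> U" using *(1)[of t t] by simp
  qed
  moreover have "abs_continuous_on J \<phi>"
    unfolding abs_continuous_on_def
    using *(2) unfolding abs_continuous_on_def by blast
  \<comment> \<open>Rational endpoints suffice, since each interior point of \<open>J\<close> lies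
    strictly inside such an interval contained in \<open>J\<close>.\<close>
  moreover have "AE t in lborel. \<forall>p::rat \<times> rat. {of_rat (fst p)..of_rat (snd p)} \<subseteq> J \<longrightarrow> t \<in> {of_rat (fst p)<..<of_rat (snd p)} \<longrightarrow>
      (\<exists>v \<in> F (\<phi> t). (\<phi> has_vector_derivative v) (at t))"
    unfolding AE_all_countable
  proof
    fix p :: "rat \<times> rat"
    define a b :: real where "a = of_rat (fst p)" and "b = of_rat (snd p)"
    show "AE t in lborel. {of_rat (fst p)..of_rat (snd p)} \<subseteq> J \<longrightarrow> t \<in> {of_rat (fst p)<..<of_rat (snd p)} \<longrightarrow>
      (\<exists>v \<in> F (\<phi> t). (\<phi> has_vector_derivative v) (at t))"
      unfolding a_def[symmetric] b_def[symmetric]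
    proof (cases "a \<le> b \<and> {a..b} \<subseteq> J")
      case True
      then show "AE t in lborel. {a..b} \<subseteq> J \<longrightarrow> t \<in> {a<..<b} \<longrightarrow>
          (\<exists>v \<in> F (\<phi> t). (\<phi> has_vector_derivative v) (at t))"
        using *(3)[of a b] by simp
    next
      case False
      then show "AE t in lborel. {a..b} \<subseteq> J \<longrightarrow> t \<in> {a<..<b} \<longrightarrow>
          (\<exists>v \<in> F (\<phi> t). (\<phi> has_vector_derivative v) (at t))"
        by (intro AE_I2) auto
    qed
  qed
  then have "AE t in lborel. t \<in> interior J \<longrightarrow> (\<exists>v \<in> F (\<phi> t). (\<phi> has_vector_derivative v) (at t))"
  proof eventually_elim
    case (elim t)
    show ?case
    proof
      assume "t \<in> interior J"
      then obtain e where "e > 0" and e: "ball t e \<subseteq> J" by (meson mem_interior)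
      obtain p where p: "t - e < of_rat p" "of_rat p < t" using of_rat_dense[of "t - e" t] \<open>e > 0\<close> by auto
      obtain q where q: "t < of_rat q" "of_rat q < t + e" using of_rat_dense[of t "t + e"] \<open>e > 0\<close> by auto
      have "{of_rat p..of_rat q} \<subseteq> ball t e"
        using p q by (auto simp: dist_real_def abs_less_iff)
      then show "\<exists>v \<in> F (\<phi> t). (\<phi> has_vector_derivative v) (at t)"
        using elim[rule_format, of "(p, q)"] p q e by auto
    qed
  qed
  ultimately show ?thesis unfolding di_solution_iff_interior using J by blast
qed

section \<open>Time reversal\<close>

lemma negligible_reflect:
  fixes S :: "real set"
  assumes "negligible S"
  shows "negligible {t. c - t \<in> S}"
proof -
  have "negligible ((\<lambda>t. c - t) ` S)"
    by (rule negligible_differentiable_image_negligible[OF order_refl assms])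
       (intro differentiable_on_diff differentiable_on_const differentiable_on_ident)
  moreover have "{t. c - t \<in> S} \<subseteq> (\<lambda>t. c - t) ` S"
    by (force simp: image_iff)
  ultimately show ?thesis by (rule negligible_subset)
qed

text \<open>By the chain rule a reflected solution has negated velocities. The centre is left free
  because two choices are needed: \<open>c = 0\<close> reverses about time 0, while
  \<open>c = t\<close> maps the interval between 0 and \<open>t\<close> onto itself and swaps its
  ends.\<close>

lemma di_solution_reflect:
  assumes "di_solution U F {a..b} \<phi>"
  shows "di_solution U (\<lambda>x. uminus ` F x) {c - b..c - a} (\<lambda>t. \<phi> (c - t))"
proof -
  have *: "\<phi> ` {a..b} \<subseteq> U" "abs_continuous_on {a..b} \<phi>"
    "AE t in lborel. t \<in> {a<..<b} \<longrightarrow> (\<exists>v \<in> F (\<phi> t). (\<phi> has_vector_derivative v) (at t))"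
    using assms unfolding di_solution_iff_interior interior_atLeastAtMost_real by blast+
  have "abs_continuous_on {c - b..c - a} (\<lambda>t. \<phi> (c - t))"
    unfolding abs_continuous_on_def
  proof (intro allI impI)
    fix u v assume uv: "u \<le> v" "{u..v} \<subseteq> {c - b..c - a}"
    then have "{c - v..c - u} \<subseteq> {a..b}" by auto
    then have "abs_continuous_on_cbox (c - v) (c - u) \<phi>"
      using *(2) uv by (simp add: abs_continuous_on_def)
    from abs_continuous_on_cbox_reflect[OF this, of c]
    show "abs_continuous_on_cbox u v (\<lambda>t. \<phi> (c - t))" by simp
  qed
  moreover have "(\<lambda>t. \<phi> (c - t)) ` {c - b..c - a} \<subseteq> U"
    using *(1) by (auto simp: image_subset_iff)
  moreover have "AE t in lborel. t \<in> {c - b<..<c - a} \<longrightarrow>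
      (\<exists>v \<in> uminus ` F (\<phi> (c - t)). ((\<lambda>t. \<phi> (c - t)) has_vector_derivative v) (at t))"
  proof -
    have "AE t in lborel. c - t \<in> {a<..<b} \<longrightarrow> (\<exists>v \<in> F (\<phi> (c - t)). (\<phi> has_vector_derivative v) (at (c - t)))"
      using negligible_reflect[OF *(3)[unfolded AE_lborel_iff_negligible], of c]
      unfolding AE_lborel_iff_negligible by simp
    then show ?thesis
    proof (rule AE_mp, intro AE_I2 impI)
      fix t assume A: "c - t \<in> {a<..<b} \<longrightarrow> (\<exists>v \<in> F (\<phi> (c - t)). (\<phi> has_vector_derivative v) (at (c - t)))"
        and t: "t \<in> {c - b<..<c - a}"
      have "c - t \<in> {a<..<b}" using t by auto
      then obtain v where v: "v \<in> F (\<phi> (c - t))" "(\<phi> has_vector_derivative v) (at (c - t))"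
        using A by blast
      have "((\<lambda>t. c - t) has_vector_derivative -1) (at t)"
        by (auto intro!: derivative_eq_intros)
      from vector_diff_chain_at[OF this v(2)]
      have "((\<lambda>t. \<phi> (c - t)) has_vector_derivative - v) (at t)" by (simp add: o_def)
      then show "\<exists>v \<in> uminus ` F (\<phi> (c - t)). ((\<lambda>t. \<phi> (c - t)) has_vector_derivative v) (at t)"
        using v by blast
    qed
  qed
  ultimately show ?thesis
    unfolding di_solution_iff_interior interior_atLeastAtMost_real
    by (simp add: is_interval_cc)
qed

text \<open>Zorn's lemma for graphs ordered by inclusion; passing to graphs removes the irrelevant
  values outside the intervals. The union of a chain is a solution because this can be tested on
  compact intervals, each of which lies in the domain of a single member.\<close>

lemma di_solution_extends_to_maximal:
  assumes sol: "di_solution U F I \<phi>" and "c \<in> I"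
  obtains J \<psi> where "I \<subseteq> J" "\<psi> \<in> extensional J" "di_maximal_solution U F J \<psi>" "\<And>t. t \<in> I \<Longrightarrow> \<psi> t = \<phi> t"
proof -
  define graph where "graph = (\<lambda>(J :: real set) (\<psi> :: real \<Rightarrow> real^'a). (\<lambda>t. (t, \<psi> t)) ` J)"
  define \<A> where "\<A> = {graph J \<psi> | J \<psi>. di_solution U F J \<psi> \<and> graph I \<phi> \<subseteq> graph J \<psi>}"
  have graph_iff: "(t, y) \<in> graph J \<psi> \<longleftrightarrow> t \<in> J \<and> y = \<psi> t" for t y J \<psi>
    by (auto simp: graph_def)
  have graph_subset: "graph J \<psi> \<subseteq> graph K \<xi> \<longleftrightarrow> J \<subseteq> K \<and> (\<forall>t\<in>J. \<psi> t = \<xi> t)" for J \<psi> K \<xi>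
    by (auto simp: graph_def)
  have "\<exists>M\<in>\<A>. \<forall>X\<in>\<A>. M \<subseteq> X \<longrightarrow> X = M"
  proof (rule subset_Zorn_nonempty)
    show "\<A> \<noteq> {}" using sol unfolding \<A>_def by blast
    fix \<C> assume "\<C> \<noteq> {}" and chain: "subset.chain \<A> \<C>"
    have CA: "\<C> \<subseteq> \<A>" using chain by (simp add: subset_chain_def)
    have cmp: "X \<subseteq> Y \<or> Y \<subseteq> X" if "X \<in> \<C>" "Y \<in> \<C>" for X Y
      using chain that unfolding subset_chain_def by blast
    define J where "J = fst ` \<Union>\<C>"
    define \<psi> where "\<psi> t = (SOME y. (t, y) \<in> \<Union>\<C>)" for t
    have func: "y = z" if ty: "(t, y) \<in> \<Union>\<C>" and tz: "(t, z) \<in> \<Union>\<C>" for t y z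
    proof -
      obtain X Y where "X \<in> \<C>" "(t, y) \<in> X" "Y \<in> \<C>" "(t, z) \<in> Y" using ty tz by blast
      then obtain X where "X \<in> \<C>" "(t, y) \<in> X" "(t, z) \<in> X" using cmp by blast
      moreover then obtain K \<xi> where "X = graph K \<xi>" using CA unfolding \<A>_def by blast
      ultimately show ?thesis by (simp add: graph_iff)
    qed
    have \<psi>: "(t, y) \<in> \<Union>\<C> \<longleftrightarrow> t \<in> J \<and> y = \<psi> t" for t y
    proof
      assume ty: "(t, y) \<in> \<Union>\<C>"
      then have "(t, \<psi> t) \<in> \<Union>\<C>" unfolding \<psi>_def by (rule someI)
      then show "t \<in> J \<and> y = \<psi> t" using func[OF ty] ty unfolding J_def by force
    next
      assume "t \<in> J \<and> y = \<psi> t"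
      moreover then obtain z where "(t, z) \<in> \<Union>\<C>" unfolding J_def by force
      then have "(t, \<psi> t) \<in> \<Union>\<C>" unfolding \<psi>_def by (rule someI)
      ultimately show "(t, y) \<in> \<Union>\<C>" by simp
    qed
    \<comment> \<open>Since the chain is totally ordered, any two times belong to the domain of one
      member; convexity of \<open>J\<close> and the compact subintervals need only their two
      endpoints.\<close>
    have member: "\<exists>K. di_solution U F K \<psi> \<and> K \<subseteq> J \<and> s \<in> K \<and> t \<in> K" if "s \<in> J" "t \<in> J" for s t
    proof -
      have "(s, \<psi> s) \<in> \<Union>\<C>" "(t, \<psi> t) \<in> \<Union>\<C>" using that \<psi> by blast+
      then obtain X where X: "X \<in> \<C>" "(s, \<psi> s) \<in> X" "(t, \<psi> t) \<in> X" using cmp by blast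
      then obtain K \<xi> where K: "X = graph K \<xi>" "di_solution U F K \<xi>" using CA unfolding \<A>_def by blast
      have "r \<in> J \<and> \<xi> r = \<psi> r" if "r \<in> K" for r
        using \<psi>[of r "\<xi> r"] X(1) K(1) that graph_iff by blast
      moreover then have "di_solution U F K \<psi>" by (intro di_solution_cong[OF K(2)]) blast
      moreover have "s \<in> K" "t \<in> K" using X K by (simp_all add: graph_iff)
      ultimately show ?thesis by blast
    qed
    have ivl: "is_interval J"
      unfolding is_interval_1
    proof (intro ballI allI impI)
      fix a b x assume "a \<in> J" "b \<in> J" and x: "a \<le> x \<and> x \<le> b"
      then obtain K where K: "di_solution U F K \<psi>" "K \<subseteq> J" "a \<in> K" "b \<in> K" using member by blast
      then have "is_interval K" by (simp add: di_solution_def)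
      then have "x \<in> K" using K x unfolding is_interval_1 by blast
      then show "x \<in> J" using K by blast
    qed
    have "di_solution U F J \<psi>"
    proof (rule di_solution_if_compact[OF ivl])
      fix a b assume ab: "a \<le> b" "{a..b} \<subseteq> J"
      then have "a \<in> J" "b \<in> J" by auto
      then obtain K where K: "di_solution U F K \<psi>" "K \<subseteq> J" "a \<in> K" "b \<in> K" using member by blast
      then have "is_interval K" by (simp add: di_solution_def)
      then have "{a..b} \<subseteq> K" using K by (intro is_interval_atLeastAtMost_subset)
      then show "di_solution U F {a..b} \<psi>" by (rule di_solution_subset[OF K(1)]) (rule is_interval_cc)
    qed
    moreover have "\<Union>\<C> = graph J \<psi>"
    proof (rule set_eqI)
      show "p \<in> \<Union>\<C> \<longleftrightarrow> p \<in> graph J \<psi>" for p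
        by (cases p) (simp only: \<psi> graph_iff)
    qed
    moreover have "graph I \<phi> \<subseteq> \<Union>\<C>"
      using \<open>\<C> \<noteq> {}\<close> CA unfolding \<A>_def by blast
    ultimately show "\<Union>\<C> \<in> \<A>" unfolding \<A>_def by auto
  qed
  then obtain M where "M \<in> \<A>" and M: "\<forall>X\<in>\<A>. M \<subseteq> X \<longrightarrow> X = M" by blast
  then obtain J \<psi>0 where J0: "M = graph J \<psi>0" "di_solution U F J \<psi>0" "graph I \<phi> \<subseteq> graph J \<psi>0"
    unfolding \<A>_def by blast
  \<comment> \<open>The restriction chooses the representative in \<open>extensional J\<close>
    without changing the graph.\<close>
  define \<psi> where "\<psi> = restrict \<psi>0 J"
  have "di_solution U F J \<psi>"
    by (rule di_solution_cong[OF J0(2)]) (simp add: \<psi>_def)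
  moreover have J: "M = graph J \<psi>" by (auto simp: J0(1) graph_def \<psi>_def)
  moreover have "K = J" if "di_solution U F K \<xi>" "J \<subseteq> K" "\<forall>t\<in>J. \<xi> t = \<psi> t" for K \<xi>
  proof -
    have "M \<subseteq> graph K \<xi>" using that by (simp add: J graph_subset)
    moreover then have "graph K \<xi> \<in> \<A>" using that J0 unfolding \<A>_def by blast
    ultimately have "graph K \<xi> = graph J \<psi>" using M J by blast
    then show ?thesis using graph_subset[of K \<xi> J \<psi>] that by blast
  qed
  ultimately have "di_maximal_solution U F J \<psi>" unfolding di_maximal_solution_def by blast
  moreover have "I \<subseteq> J \<and> (\<forall>t\<in>I. \<phi> t = \<psi> t)"
    using J0(3) J J0(1) graph_subset by metis
  ultimately show thesis using that[of J \<psi>] by (auto simp: \<psi>_def)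
qed

text \<open>\<open>min\<close> and \<open>max\<close> give the closed interval between 0 and
  \<open>t\<close> for either sign of \<open>t\<close>. Maximality is dropped, since a solution on
  this interval can always be extended.\<close>

definition reachable ::
  "(real^'n) set \<Rightarrow> (real^'n \<Rightarrow> (real^'n) set) \<Rightarrow> real \<Rightarrow> real^'n \<Rightarrow> real^'n \<Rightarrow> bool" where
  "reachable U F t x y \<longleftrightarrow> (\<exists>\<phi>. di_solution U F {min 0 t..max 0 t} \<phi> \<and> \<phi> 0 = x \<and> \<phi> t = y)"

lemma reachable_if_di_solution:
  assumes "di_solution U F I \<phi>" "0 \<in> I" "t \<in> I"
  shows "reachable U F t (\<phi> 0) (\<phi> t)"
proof -
  have "is_interval I" using assms(1) by (simp add: di_solution_def)
  then have "{min 0 t..max 0 t} \<subseteq> I"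
    using assms(2,3) by (intro is_interval_atLeastAtMost_subset) (simp_all add: min_def max_def)
  then have "di_solution U F {min 0 t..max 0 t} \<phi>"
    by (rule di_solution_subset[OF assms(1)]) (rule is_interval_cc)
  then show ?thesis unfolding reachable_def by blast
qed

lemma reachable_in_domain:
  assumes "reachable U F t x y"
  shows "x \<in> U" "y \<in> U"
proof -
  obtain \<phi> where \<phi>: "di_solution U F {min 0 t..max 0 t} \<phi>" "\<phi> 0 = x" "\<phi> t = y"
    using assms unfolding reachable_def by blast
  have "\<phi> ` {min 0 t..max 0 t} \<subseteq> U" using \<phi>(1) by (simp add: di_solution_def)
  moreover have "0 \<in> {min 0 t..max 0 t}" "t \<in> {min 0 t..max 0 t}" by auto
  ultimately show "x \<in> U" "y \<in> U" using \<phi>(2,3) by blast+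
qed

text \<open>Maximal solutions restrict to the interval between 0 and \<open>t\<close>, and solutions
  there extend to maximal ones. From here on images are handled through \<open>reachable\<close>
  alone.\<close>

lemma solution_image_eq: "solution_image U F A t = {y. \<exists>x\<in>A. reachable U F t x y}"
proof (intro equalityI subsetI)
  fix y assume "y \<in> solution_image U F A t"
  then obtain x I \<phi> where *: "x \<in> A" "y = \<phi> t" "(I, \<phi>) \<in> max_solutions U F x" "t \<in> I"
    unfolding solution_image_def by blast
  then have "reachable U F t (\<phi> 0) (\<phi> t)"
    by (intro reachable_if_di_solution[where I = I]) (auto simp: max_solutions_def di_maximal_solution_def)
  then show "y \<in> {y. \<exists>x\<in>A. reachable U F t x y}" using * by (auto simp: max_solutions_def)
next
  fix y assume "y \<in> {y. \<exists>x\<in>A. reachable U F t x y}"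
  then obtain x \<phi> where *: "x \<in> A" "di_solution U F {min 0 t..max 0 t} \<phi>" "\<phi> 0 = x" "\<phi> t = y"
    unfolding reachable_def by blast
  have in_I: "0 \<in> {min 0 t..max 0 t}" "t \<in> {min 0 t..max 0 t}" by auto
  obtain J \<psi> where J: "{min 0 t..max 0 t} \<subseteq> J" "\<psi> \<in> extensional J" "di_maximal_solution U F J \<psi>"
      "\<And>s. s \<in> {min 0 t..max 0 t} \<Longrightarrow> \<psi> s = \<phi> s"
    using di_solution_extends_to_maximal[OF *(2) in_I(1)] by blast
  have "(J, \<psi>) \<in> max_solutions U F x" "t \<in> J" "\<psi> t = y"
    using J * in_I unfolding max_solutions_def by auto
  then show "y \<in> solution_image U F A t" unfolding solution_image_def using \<open>x \<in> A\<close> by blast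
qed

lemma uminus_uminus_image: "uminus ` uminus ` S = (S :: 'a::group_add set)"
  by (simp add: image_image)

text \<open>One reflection about 0 negates both time and \<open>F\<close>. A reflection about
  \<open>t\<close> followed by one about 0 is the time shift \<open>\<phi> (t + s)\<close>, which
  restores \<open>F\<close> and exchanges the roles of \<open>x\<close> and
  \<open>y\<close>.\<close>

lemma reachable_reflect:
  assumes "reachable U F t x y"
  shows "reachable U (\<lambda>x. uminus ` F x) (- t) x y" and "reachable U F (- t) y x"
proof -
  obtain \<phi> where \<phi>: "di_solution U F {min 0 t..max 0 t} \<phi>" "\<phi> 0 = x" "\<phi> t = y"
    using assms unfolding reachable_def by blast
  have ivl: "{0 - max 0 t..0 - min 0 t} = {min 0 (- t)..max 0 (- t)}" by auto
  have ivl': "{t - max 0 t..t - min 0 t} = {min 0 t..max 0 t}" by auto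
  have R: "di_solution U (\<lambda>x. uminus ` F x) {min 0 (- t)..max 0 (- t)} (\<lambda>s. \<phi> (0 - s))"
    using di_solution_reflect[OF \<phi>(1), of 0] unfolding ivl .
  then show "reachable U (\<lambda>x. uminus ` F x) (- t) x y"
    unfolding reachable_def using \<phi>(2,3) by (intro exI[of _ "\<lambda>s. \<phi> (0 - s)"]) simp
  have "di_solution U (\<lambda>x. uminus ` F x) {min 0 t..max 0 t} (\<lambda>s. \<phi> (t - s))"
    using di_solution_reflect[OF \<phi>(1), of t] unfolding ivl' .
  from di_solution_reflect[OF this, of 0]
  have "di_solution U F {min 0 (- t)..max 0 (- t)} (\<lambda>s. \<phi> (t - (0 - s)))"
    unfolding ivl uminus_uminus_image .
  then show "reachable U F (- t) y x"
    unfolding reachable_def using \<phi>(2,3) by (intro exI[of _ "\<lambda>s. \<phi> (t - (0 - s))"]) simp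
qed

text \<open>If two maximal solutions agreed on the intersection of their domains, they could be
  glued along time 0. Maximality would force both domains to equal the union, and
  \<open>extensional\<close> would make the two functions equal.\<close>

lemma nonuniqueness_set_branches:
  assumes "x \<in> nonuniqueness_set U F"
  obtains t y z where "reachable U F t x y" "reachable U F t x z" "y \<noteq> z"
proof -
  obtain I \<phi> J \<psi> where I: "(I, \<phi>) \<in> max_solutions U F x" and J: "(J, \<psi>) \<in> max_solutions U F x"
    and ne: "(I, \<phi>) \<noteq> (J, \<psi>)"
    using assms unfolding nonuniqueness_set_def by auto
  have I': "\<phi> \<in> extensional I" "di_solution U F I \<phi>" "0 \<in> I" "\<phi> 0 = x"
    and max_I: "\<And>K \<xi>. di_solution U F K \<xi> \<Longrightarrow> I \<subseteq> K \<Longrightarrow> \<forall>t\<in>I. \<xi> t = \<phi> t \<Longrightarrow> K = I"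
    using I unfolding max_solutions_def di_maximal_solution_def by blast+
  have J': "\<psi> \<in> extensional J" "di_solution U F J \<psi>" "0 \<in> J" "\<psi> 0 = x"
    and max_J: "\<And>K \<xi>. di_solution U F K \<xi> \<Longrightarrow> J \<subseteq> K \<Longrightarrow> \<forall>t\<in>J. \<xi> t = \<psi> t \<Longrightarrow> K = J"
    using J unfolding max_solutions_def di_maximal_solution_def by blast+
  have "\<exists>t\<in>I \<inter> J. \<phi> t \<noteq> \<psi> t"
  proof (rule ccontr)
    assume "\<not> (\<exists>t\<in>I \<inter> J. \<phi> t \<noteq> \<psi> t)"
    then have eq: "\<phi> t = \<psi> t" if "t \<in> I" "t \<in> J" for t using that by blast
    define \<xi> where "\<xi> t = (if t \<in> I then \<phi> t else \<psi> t)" for t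
    have "\<forall>t\<in>I. \<xi> t = \<phi> t" "\<forall>t\<in>J. \<xi> t = \<psi> t" using eq by (auto simp: \<xi>_def)
    moreover then have "di_solution U F I \<xi>" "di_solution U F J \<xi>"
      using di_solution_cong[OF I'(2), of \<xi>] di_solution_cong[OF J'(2), of \<xi>] by auto
    then have "di_solution U F (I \<union> J) \<xi>" using I'(3) J'(3) by (rule di_solution_Un)
    ultimately have "I \<union> J = I" "I \<union> J = J" using max_I[of "I \<union> J"] max_J[of "I \<union> J"] by blast+
    then have "I = J" by blast
    moreover then have "\<phi> = \<psi>"
      using I'(1) J'(1) eq by (intro extensionalityI[of \<phi> I \<psi>]) auto
    ultimately show False using ne by blast
  qed
  then obtain t where "t \<in> I" "t \<in> J" "\<phi> t \<noteq> \<psi> t" by blast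
  then show thesis
    using that[of t "\<phi> t" "\<psi> t"] reachable_if_di_solution[OF I'(2,3), of t]
      reachable_if_di_solution[OF J'(2,3), of t] I'(4) J'(4) by simp
qed

lemma saturation_reachable:
  assumes "y \<in> saturation U F V"
  obtains x t where "x \<in> V" "reachable U F t x y"
proof -
  obtain x I \<phi> t where "x \<in> V" "(I, \<phi>) \<in> max_solutions U F x" "t \<in> I" "y = \<phi> t"
    using assms unfolding saturation_def by blast
  moreover then have "reachable U F t (\<phi> 0) (\<phi> t)"
    by (intro reachable_if_di_solution[where I = I]) (auto simp: max_solutions_def di_maximal_solution_def)
  ultimately show thesis using that by (auto simp: max_solutions_def)
qed

section \<open>Perturbation of solutions\<close>

text \<open>The projection depends on the set like the square root of the Hausdorff distance, which
  \<open>h\<close> bounds. Each projection satisfies its obtuse-angle inequality, tested with the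
  point of its own set that is close to the other projection.\<close>

lemma closest_point_set_perturbation:
  fixes v :: "'a::euclidean_space"
  assumes S: "convex S" "closed S" "S \<noteq> {}" and T: "convex T" "closed T" "T \<noteq> {}"
    and ST: "\<And>s. s \<in> S \<Longrightarrow> \<exists>t\<in>T. norm (s - t) \<le> h" and TS: "\<And>t. t \<in> T \<Longrightarrow> \<exists>s\<in>S. norm (t - s) \<le> h"
  shows "(norm (closest_point T v - closest_point S v))\<^sup>2 \<le> h * (2 * norm (v - closest_point S v) + h)"
proof -
  define p q where "p = closest_point S v" and "q = closest_point T v"
  have "p \<in> S" "q \<in> T" using S T by (simp_all add: p_def q_def closest_point_in_set)
  obtain q' where q': "q' \<in> S" "norm (q - q') \<le> h" using TS \<open>q \<in> T\<close> by blast
  obtain p' where p': "p' \<in> T" "norm (p - p') \<le> h" using ST \<open>p \<in> S\<close> by blast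
  have "0 \<le> h" using q'(2) norm_ge_zero order_trans by blast
  have "norm (v - q) \<le> norm (v - p')"
    using closest_point_le[OF T(2) p'(1), of v] by (simp add: q_def dist_norm)
  also have "\<dots> \<le> norm (v - p) + h"
    using norm_triangle_ineq[of "v - p" "p - p'"] p'(2) by simp
  finally have d': "norm (v - q) \<le> norm (v - p) + h" .
  have "(v - p) \<bullet> (q' - p) \<le> 0" "(v - q) \<bullet> (p' - q) \<le> 0"
    using closest_point_dot[OF S(1,2) q'(1), of v] closest_point_dot[OF T(1,2) p'(1), of v]
    by (simp_all add: p_def q_def)
  \<comment> \<open>Adding both inequalities isolates the squared distance; each remaining term
    contains a difference of norm at most \<open>h\<close>.\<close>
  then have "(q - p) \<bullet> (q - p) \<le> (v - p) \<bullet> (q - q') + (v - q) \<bullet> (p - p')"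
    by (simp add: inner_diff_left inner_diff_right inner_commute)
  also have "\<dots> \<le> norm (v - p) * h + norm (v - q) * h"
  proof (rule add_mono)
    show "(v - p) \<bullet> (q - q') \<le> norm (v - p) * h"
      by (rule order_trans[OF norm_cauchy_schwarz mult_left_mono[OF q'(2)]]) simp
    show "(v - q) \<bullet> (p - p') \<le> norm (v - q) * h"
      by (rule order_trans[OF norm_cauchy_schwarz mult_left_mono[OF p'(2)]]) simp
  qed
  also have "\<dots> \<le> norm (v - p) * h + (norm (v - p) + h) * h"
    using mult_right_mono[OF d' \<open>0 \<le> h\<close>] by simp
  finally show ?thesis
    unfolding p_def q_def power2_norm_eq_inner by (simp add: algebra_simps)
qed

lemma geometric_steps_converge:
  fixes a :: "nat \<Rightarrow> 'a::banach"
  assumes step: "\<And>k. norm (a (Suc k) - a k) \<le> M / 2 ^ k"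
  shows "\<exists>l. a \<longlonglongrightarrow> l \<and> (\<forall>k. norm (a k - l) \<le> 2 * M / 2 ^ k)"
proof -
  have "0 \<le> M" using order_trans[OF norm_ge_zero step[of 0]] by simp
  \<comment> \<open>The right side is the exact partial sum of the geometric series; the weaker
    bound \<open>2 * M / 2 ^ k\<close> would not survive the induction.\<close>
  have bound: "norm (a (k + n) - a k) \<le> 2 * M / 2 ^ k - 2 * M / 2 ^ (k + n)" for k n
  proof (induction n)
    case (Suc n)
    have "norm (a (k + Suc n) - a k) \<le> norm (a (Suc (k + n)) - a (k + n)) + norm (a (k + n) - a k)"
      using norm_triangle_ineq[of "a (Suc (k + n)) - a (k + n)" "a (k + n) - a k"] by simp
    also have "\<dots> \<le> M / 2 ^ (k + n) + (2 * M / 2 ^ k - 2 * M / 2 ^ (k + n))"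
      using step[of "k + n"] Suc by linarith
    also have "\<dots> = 2 * M / 2 ^ k - 2 * M / 2 ^ (k + Suc n)"
      by (simp add: field_simps)
    finally show ?case .
  qed simp
  have le: "norm (a m - a k) \<le> 2 * M / 2 ^ k" if "k \<le> m" for k m
  proof -
    have "norm (a m - a k) \<le> 2 * M / 2 ^ k - 2 * M / 2 ^ m"
      using bound[of k "m - k"] that by simp
    moreover have "0 \<le> 2 * M / 2 ^ m" using \<open>0 \<le> M\<close> by simp
    ultimately show ?thesis by linarith
  qed
  have lim0: "(\<lambda>k. 2 * M / 2 ^ k) \<longlonglongrightarrow> 0"
    by (rule LIMSEQ_divide_realpow_zero) simp
  have "Cauchy a"
  proof (rule metric_CauchyI)
    fix e :: real assume "0 < e"
    then obtain N where N: "2 * M / 2 ^ N < e / 2"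
      using order_tendstoD(2)[OF lim0, of "e / 2"] by (auto simp: eventually_sequentially)
    have "dist (a m) (a n) < e" if "N \<le> m" "N \<le> n" for m n
    proof -
      have "dist (a m) (a n) \<le> dist (a m) (a N) + dist (a n) (a N)" by (rule dist_triangle2)
      also have "\<dots> < e" using le[OF that(1)] le[OF that(2)] N unfolding dist_norm by linarith
      finally show ?thesis .
    qed
    then show "\<exists>N. \<forall>m\<ge>N. \<forall>n\<ge>N. dist (a m) (a n) < e" by blast
  qed
  then obtain l where l: "a \<longlonglongrightarrow> l" using Cauchy_convergent convergent_def by blast
  have "norm (a k - l) \<le> 2 * M / 2 ^ k" for k
  proof (rule Lim_bounded)
    show "(\<lambda>m. norm (a k - a m)) \<longlonglongrightarrow> norm (a k - l)"
      by (intro tendsto_intros l)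
    show "\<forall>m\<ge>k. norm (a k - a m) \<le> 2 * M / 2 ^ k"
      by (intro allI impI) (subst norm_minus_commute, rule le)
  qed
  then show ?thesis using l by blast
qed

text \<open>Picking the velocity pointwise from the solution property says nothing about
  measurability. A limit of difference quotients along a fixed sequence is measurable and equals the
  derivative wherever that exists.\<close>

lemma measurable_derivative:
  fixes \<phi> :: "real \<Rightarrow> 'a::euclidean_space"
  assumes cont: "continuous_on {0..T} \<phi>"
  obtains D where "D \<in> borel_measurable borel"
    "\<And>t v. t \<in> {0<..<T} \<Longrightarrow> (\<phi> has_vector_derivative v) (at t) \<Longrightarrow> D t = v"
proof -
  \<comment> \<open>Clamping extends \<open>\<phi>\<close> continuously to the whole line, so the
    quotients are Borel functions everywhere. For negative \<open>T\<close> the clamped time leaves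
    the empty domain, hence the case split.\<close>
  define g where "g t = \<phi> (max 0 (min T t))" for t
  define h where "h n = inverse (real (Suc n))" for n
  define D where "D t = lim (\<lambda>n. (g (t + h n) - g t) /\<^sub>R h n)" for t
  show thesis
  proof (cases "0 \<le> T")
    case True
    have "continuous_on UNIV g"
      unfolding g_def
      by (rule continuous_on_compose2[OF cont]) (use True in \<open>auto intro!: continuous_intros\<close>)
    then have g[measurable]: "g \<in> borel_measurable borel" by (rule borel_measurable_continuous_onI)
    have "D \<in> borel_measurable borel" unfolding D_def by measurable
    moreover have "D t = v" if t: "t \<in> {0<..<T}" and v: "(\<phi> has_vector_derivative v) (at t)" for t v
    proof -
      have "(g has_vector_derivative v) (at t)"
        by (rule has_vector_derivative_transform_within_open[OF v, of "{0<..<T}"]) (use t in \<open>auto simp: g_def\<close>)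
      then have lim: "((\<lambda>x. norm (g (t + x) - g t - x *\<^sub>R v) / norm x) \<longlongrightarrow> 0) (at 0)"
        unfolding has_vector_derivative_def has_derivative_at by blast
      have "filterlim h (at 0) sequentially"
        unfolding filterlim_at h_def using LIMSEQ_inverse_real_of_nat by (auto simp: eventually_sequentially)
      from filterlim_compose[OF lim this]
      have "(\<lambda>n. norm (g (t + h n) - g t - h n *\<^sub>R v) / norm (h n)) \<longlonglongrightarrow> 0" .
      moreover have "norm (g (t + h n) - g t - h n *\<^sub>R v) / norm (h n) = norm ((g (t + h n) - g t) /\<^sub>R h n - v)" for n
      proof -
        have "h n > 0" by (simp add: h_def)
        then have "(g (t + h n) - g t) /\<^sub>R h n - v = (g (t + h n) - g t - h n *\<^sub>R v) /\<^sub>R h n"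
          by (simp add: scaleR_diff_right)
        then show ?thesis using \<open>h n > 0\<close> by (simp only: norm_scaleR) (simp add: divide_inverse_commute)
      qed
      ultimately have "(\<lambda>n. (g (t + h n) - g t) /\<^sub>R h n - v) \<longlonglongrightarrow> 0"
        by (simp add: tendsto_norm_zero_iff)
      then have "(\<lambda>n. (g (t + h n) - g t) /\<^sub>R h n) \<longlonglongrightarrow> v" by (simp add: LIM_zero_iff)
      then show "D t = v" unfolding D_def by (rule limI)
    qed
    ultimately show thesis using that by blast
  next
    case False
    then show thesis using that[of "\<lambda>_. 0"] by auto
  qed
qed

text \<open>Nonempty values make \<open>closest_point\<close> meaningful; the case of empty values
  is split off in the final theorem. The Lipschitz condition is put as the existence of a nearby
  velocity, which serves as a competitor for the projection.\<close>

locale lipschitz_inclusion =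
  fixes U :: "(real^'n) set" and F :: "real^'n \<Rightarrow> (real^'n) set" and L :: real
  assumes open_U: "open U"
    and closed_F: "x \<in> U \<Longrightarrow> closed (F x)"
    and convex_F: "x \<in> U \<Longrightarrow> convex (F x)"
    and nonempty_F: "x \<in> U \<Longrightarrow> F x \<noteq> {}"
    and L_pos: "L > 0"
    and lipschitz_F: "x \<in> U \<Longrightarrow> x' \<in> U \<Longrightarrow> v \<in> F x \<Longrightarrow> \<exists>v'\<in>F x'. norm (v - v') \<le> L * norm (x - x')"
begin

section \<open>Projection onto the admissible velocities\<close>

lemma closest_point_in_F: "x \<in> U \<Longrightarrow> closest_point (F x) v \<in> F x"
  by (rule closest_point_in_set[OF closed_F nonempty_F])

lemma closest_point_F_le:
  assumes "x \<in> U" "x' \<in> U" "v \<in> F x"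
  shows "norm (closest_point (F x') v - v) \<le> L * norm (x - x')"
proof -
  obtain v' where v': "v' \<in> F x'" "norm (v - v') \<le> L * norm (x - x')"
    using lipschitz_F[OF assms] by blast
  have "dist v (closest_point (F x') v) \<le> dist v v'"
    by (rule closest_point_le[OF closed_F[OF assms(2)] v'(1)])
  then show ?thesis using v'(2) by (simp add: dist_norm norm_minus_commute)
qed

text \<open>For a fixed set the projection is 1-Lipschitz in the velocity; moving the base point
  changes the set by at most \<open>L\<close> times the displacement and costs the square-root term.
  This continuity is what makes projected velocities measurable.\<close>

lemma continuous_on_closest_point_F:
  "continuous_on (U \<times> UNIV) (\<lambda>p. closest_point (F (fst p)) (snd p))"
  unfolding continuous_on_def
proof
  fix p assume "p \<in> U \<times> (UNIV :: (real^'n) set)"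
  then have x0: "fst p \<in> U" by auto
  define x0 v0 where "x0 = fst p" and "v0 = snd p"
  define d where "d = norm (v0 - closest_point (F x0) v0)"
  define b where "b q = norm (snd q - v0) + sqrt (L * norm (x0 - fst q) * (2 * d + L * norm (x0 - fst q)))"
    for q :: "(real^'n) \<times> (real^'n)"
  have "(b \<longlongrightarrow> norm (snd p - v0) + sqrt (L * norm (x0 - fst p) * (2 * d + L * norm (x0 - fst p)))) (at p within U \<times> UNIV)"
    unfolding b_def by (intro tendsto_intros)
  then have b: "(b \<longlongrightarrow> 0) (at p within U \<times> UNIV)" by (simp add: x0_def v0_def)
  have le: "norm (closest_point (F (fst q)) (snd q) - closest_point (F x0) v0) \<le> b q" if "q \<in> U \<times> UNIV" for q
  proof -
    have x: "fst q \<in> U" using that by auto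
    have "dist (closest_point (F (fst q)) (snd q)) (closest_point (F (fst q)) v0) \<le> dist (snd q) v0"
      by (rule closest_point_lipschitz[OF convex_F[OF x] closed_F[OF x] nonempty_F[OF x]])
    moreover have "(norm (closest_point (F (fst q)) v0 - closest_point (F x0) v0))\<^sup>2
        \<le> L * norm (x0 - fst q) * (2 * d + L * norm (x0 - fst q))"
      unfolding d_def
    proof (rule closest_point_set_perturbation)
      show "\<exists>t\<in>F (fst q). norm (s - t) \<le> L * norm (x0 - fst q)" if "s \<in> F x0" for s
        using lipschitz_F[of x0 "fst q" s] x0 x that by (simp add: x0_def)
      show "\<exists>s\<in>F x0. norm (t - s) \<le> L * norm (x0 - fst q)" if "t \<in> F (fst q)" for t
        using lipschitz_F[of "fst q" x0 t] x0 x that by (simp add: x0_def norm_minus_commute)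
    qed (use x0 x convex_F closed_F nonempty_F in \<open>simp_all add: x0_def\<close>)
    then have "norm (closest_point (F (fst q)) v0 - closest_point (F x0) v0)
        \<le> sqrt (L * norm (x0 - fst q) * (2 * d + L * norm (x0 - fst q)))"
      by (rule real_le_rsqrt)
    ultimately show ?thesis
      using norm_triangle_ineq[of "closest_point (F (fst q)) (snd q) - closest_point (F (fst q)) v0"
          "closest_point (F (fst q)) v0 - closest_point (F x0) v0"]
      unfolding b_def dist_norm by simp
  qed
  have "((\<lambda>q. closest_point (F (fst q)) (snd q) - closest_point (F x0) v0) \<longlongrightarrow> 0) (at p within U \<times> UNIV)"
    by (rule Lim_null_comparison[OF _ b]) (auto simp: eventually_at_filter intro!: always_eventually le)
  then show "((\<lambda>q. closest_point (F (fst q)) (snd q)) \<longlongrightarrow> closest_point (F (fst p)) (snd p)) (at p within U \<times> UNIV)"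
    unfolding x0_def v0_def by (simp add: LIM_zero_iff)
qed

lemma borel_measurable_closest_point_F:
  assumes x: "x \<in> borel_measurable M" and v: "v \<in> borel_measurable M"
    and U: "\<And>t. t \<in> space M \<Longrightarrow> x t \<in> U"
  shows "(\<lambda>t. closest_point (F (x t)) (v t)) \<in> borel_measurable M"
proof -
  have "(\<lambda>t. (x t, v t)) \<in> measurable M (restrict_space borel (U \<times> UNIV))"
    by (rule measurable_restrict_space2) (use U in auto, intro borel_measurable_Pair x v)
  from measurable_compose[OF this borel_measurable_continuous_on_restrict[OF continuous_on_closest_point_F]]
  show ?thesis by simp
qed

text \<open>
  Filippov's iteration. Each new velocity is the projection of the previous one, which differs
  from it only by \<open>L\<close> times the last change of position; in the norm weighted with
  \<open>exp (- 2 * L * t)\<close> this change is halved in every round. Only the bounded correction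
  \<open>u\<close> is integrated, never the derivative of \<open>\<phi>\<close> itself, so that the fundamental theorem of
  calculus for absolutely continuous functions is not needed.
\<close>

lemma filippov_correction:
  assumes "0 \<le> T" and \<phi>: "continuous_on {0..T} \<phi>" and D: "D \<in> borel_measurable (lebesgue_on {0..T})"
    and D_F: "\<And>t. t \<in> {0..T} \<Longrightarrow> D t \<in> F (\<phi> t)"
    and tube: "\<And>t x. t \<in> {0..T} \<Longrightarrow> norm x \<le> 2 * norm z * exp (2 * L * T) \<Longrightarrow> \<phi> t + x \<in> U"
  obtains u where "u integrable_on {0..T}"
    "\<And>t. t \<in> {0..T} \<Longrightarrow> norm (u t) \<le> 2 * L * norm z * exp (2 * L * T)"
    "\<And>t. t \<in> {0..T} \<Longrightarrow> norm (z + integral {0..t} u) \<le> 2 * norm z * exp (2 * L * T)"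
    "\<And>t. t \<in> {0..T} \<Longrightarrow> D t + u t \<in> F (\<phi> t + (z + integral {0..t} u))"
proof -
  define c where "c = norm z"
  have "0 \<le> c" by (simp add: c_def)
  \<comment> \<open>\<open>w v\<close> is the displacement from \<open>\<phi>\<close> of the curve
    with velocity \<open>v\<close> that starts at distance vector \<open>z\<close>. Velocity
    \<open>D\<close> itself gives the constant displacement \<open>z\<close>, the start of the
    iteration.\<close>
  define w where "w v t = z + integral {0..t} (\<lambda>s. v s - D s)" for v t
  define V where "V = rec_nat D (\<lambda>_ v t. closest_point (F (\<phi> t + w v t)) (v t))"
  have V0: "V 0 = D" and VS: "V (Suc k) = (\<lambda>t. closest_point (F (\<phi> t + w (V k) t)) (V k t))" for k
    by (simp_all add: V_def)
  \<comment> \<open>The weight starts at \<open>E 0 = norm z\<close>; its growth rate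
    \<open>2 * L\<close>, twice the Lipschitz constant, is responsible for the contraction factor
    1/2.\<close>
  define E where "E t = c * exp (2 * L * t)" for t
  have E_pos: "0 \<le> E t" for t using \<open>0 \<le> c\<close> by (simp add: E_def)
  have E_le: "E t \<le> c * exp (2 * L * T)" if "t \<in> {0..T}" for t
    unfolding E_def using that L_pos \<open>0 \<le> c\<close> by (intro mult_left_mono) auto
  \<comment> \<open>As \<open>E\<close> has derivative \<open>2 * L * E\<close>, integrating a
    velocity change bounded by \<open>L * B * E\<close> yields a position change of at most
    \<open>B * E / 2\<close>.\<close>
  have E_int: "((\<lambda>s. L * B * E s) has_integral B * (E t - c) / 2) {0..t}" if "0 \<le> t" for t B
  proof -
    have "((\<lambda>s. L * B * E s) has_integral B * E t / 2 - B * E 0 / 2) {0..t}"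
    proof (rule fundamental_theorem_of_calculus[OF that])
      fix s
      have "((\<lambda>s. B * E s / 2) has_real_derivative L * B * E s) (at s within {0..t})"
        unfolding E_def by (auto intro!: derivative_eq_intros)
      then show "((\<lambda>s. B * E s / 2) has_vector_derivative L * B * E s) (at s within {0..t})"
        by (simp add: has_real_derivative_iff_has_vector_derivative)
    qed
    then show ?thesis by (simp add: E_def diff_divide_distrib right_diff_distrib)
  qed
  have int: "(\<lambda>s. v s - D s) integrable_on {0..t}"
    if v: "v \<in> borel_measurable (lebesgue_on {0..T})" and bd: "\<And>s. s \<in> {0..T} \<Longrightarrow> norm (v s - D s) \<le> B"
      and t: "t \<in> {0..T}" for v B t
  proof -
    have "(\<lambda>s. v s - D s) integrable_on {0..T}"
    proof (rule measurable_bounded_by_integrable_imp_integrable)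
      show "(\<lambda>s. v s - D s) \<in> borel_measurable (lebesgue_on {0..T})"
        by (intro borel_measurable_diff v D)
      show "(\<lambda>_. B) integrable_on {0..T}" by (rule integrable_const_ivl)
    qed (use bd in auto)
    then show ?thesis by (rule integrable_on_subinterval) (use t in auto)
  qed
  have close_w: "norm (w v' t - w v t) \<le> J"
    if v: "v \<in> borel_measurable (lebesgue_on {0..T})" and bd: "\<And>s. s \<in> {0..T} \<Longrightarrow> norm (v s - D s) \<le> B"
      and v': "v' \<in> borel_measurable (lebesgue_on {0..T})" and bd': "\<And>s. s \<in> {0..T} \<Longrightarrow> norm (v' s - D s) \<le> B'"
      and t: "t \<in> {0..T}" and J: "(g has_integral J) {0..t}"
      and le: "\<And>s. s \<in> {0..t} \<Longrightarrow> norm (v' s - v s) \<le> g s" for v v' B B' t J g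
  proof -
    note i = int[OF v bd t] and i' = int[OF v' bd' t]
    have "w v' t - w v t = integral {0..t} (\<lambda>s. v' s - D s) - integral {0..t} (\<lambda>s. v s - D s)"
      by (simp add: w_def)
    also have "\<dots> = integral {0..t} (\<lambda>s. (v' s - D s) - (v s - D s))"
      by (rule Henstock_Kurzweil_Integration.integral_diff[OF i' i, symmetric])
    finally have "w v' t - w v t = integral {0..t} (\<lambda>s. (v' s - D s) - (v s - D s))" .
    moreover have "norm (integral {0..t} (\<lambda>s. (v' s - D s) - (v s - D s))) \<le> integral {0..t} g"
      by (rule Henstock_Kurzweil_Integration.integral_norm_bound_integral[OF integrable_diff[OF i' i]])
         (use J le in auto)
    ultimately show ?thesis using J by (simp add: integral_unique)
  qed
  have w_cont: "continuous_on {0..T} (w v)"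
    if v: "v \<in> borel_measurable (lebesgue_on {0..T})" and bd: "\<And>s. s \<in> {0..T} \<Longrightarrow> norm (v s - D s) \<le> B" for v B
    unfolding w_def using int[OF v bd, of T] \<open>0 \<le> T\<close>
    by (intro continuous_on_add continuous_on_const indefinite_integral_continuous_1) auto
  \<comment> \<open>A bound independent of the time and of the iterate: it makes all corrections
    integrable and passes to the limit as the bound on \<open>u\<close>.\<close>
  define B where "B = 2 * L * norm z * exp (2 * L * T)"
  have le_B: "2 * L * E t * (1 - 1 / 2 ^ k) \<le> B" if "t \<in> {0..T}" for t k
  proof -
    have "2 * L * E t * (1 - 1 / 2 ^ k) \<le> 2 * L * E t * 1"
      using L_pos E_pos[of t] by (intro mult_left_mono) auto
    also have "\<dots> \<le> B"
      using mult_left_mono[OF E_le[OF that], of "2 * L"] L_pos by (simp add: B_def c_def)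
    finally show ?thesis .
  qed
  have le_2E: "E t * (2 - 1 / 2 ^ k) \<le> 2 * norm z * exp (2 * L * T)" if "t \<in> {0..T}" for t k
  proof -
    have "E t * (2 - 1 / 2 ^ k) \<le> E t * 2"
      using E_pos[of t] by (intro mult_left_mono) auto
    also have "\<dots> \<le> 2 * norm z * exp (2 * L * T)"
      using E_le[OF that] by (simp add: c_def)
    finally show ?thesis .
  qed
  \<comment> \<open>The second and third bounds are the partial sums obtained from velocity steps
    \<open>L * E t / 2 ^ j\<close> and displacement steps \<open>E t / 2 ^ Suc j\<close>, the latter
    added to the initial \<open>E t\<close>. They belong to the induction because each new
    projection requires the position to remain in the tube inside \<open>U\<close>.\<close>
  have iterates: "V k \<in> borel_measurable (lebesgue_on {0..T}) \<and>
    (\<forall>t\<in>{0..T}. norm (V k t - D t) \<le> 2 * L * E t * (1 - 1 / 2 ^ k)) \<and>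
    (\<forall>t\<in>{0..T}. norm (w (V k) t) \<le> E t * (2 - 1 / 2 ^ k)) \<and>
    (\<forall>t\<in>{0..T}. norm (V (Suc k) t - V k t) \<le> L * E t / 2 ^ k)" for k
  proof (induction k)
    case 0
    have "w D t = z" for t by (simp add: w_def)
    moreover have z_le: "norm z \<le> E t" if "t \<in> {0..T}" for t
      using that L_pos mult_left_mono[of 1 "exp (2 * L * t)" c] \<open>0 \<le> c\<close> by (simp add: E_def c_def)
    moreover have "norm (closest_point (F (\<phi> t + z)) (D t) - D t) \<le> L * E t" if t: "t \<in> {0..T}" for t
    proof -
      have "norm (closest_point (F (\<phi> t + z)) (D t) - D t) \<le> L * norm (\<phi> t - (\<phi> t + z))"
      proof (rule closest_point_F_le[OF _ _ D_F[OF t]])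
        have "norm z \<le> 2 * norm z * exp (2 * L * T)"
          using z_le[OF t] E_le[OF t] E_pos[of t] by (simp add: c_def)
        then show "\<phi> t + z \<in> U" by (rule tube[OF t])
        show "\<phi> t \<in> U" using tube[OF t, of 0] by simp
      qed
      also have "\<dots> \<le> L * E t" using z_le[OF t] L_pos by (simp add: mult_left_mono)
      finally show ?thesis .
    qed
    ultimately show ?case using D unfolding VS V0 by simp
  next
    case (Suc k)
    then have meas: "V k \<in> borel_measurable (lebesgue_on {0..T})"
      and bd: "\<And>t. t \<in> {0..T} \<Longrightarrow> norm (V k t - D t) \<le> 2 * L * E t * (1 - 1 / 2 ^ k)"
      and w_le: "\<And>t. t \<in> {0..T} \<Longrightarrow> norm (w (V k) t) \<le> E t * (2 - 1 / 2 ^ k)"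
      and step: "\<And>t. t \<in> {0..T} \<Longrightarrow> norm (V (Suc k) t - V k t) \<le> L * E t / 2 ^ k"
      by blast+
    have bd_B: "norm (V k t - D t) \<le> B" if "t \<in> {0..T}" for t
      using bd[OF that] le_B[OF that] by (rule order_trans)
    have dom: "\<phi> t + w (V k) t \<in> U" if "t \<in> {0..T}" for t
      using order_trans[OF w_le[OF that] le_2E[OF that]] by (rule tube[OF that])
    have meas': "V (Suc k) \<in> borel_measurable (lebesgue_on {0..T})"
      unfolding VS
    proof (rule borel_measurable_closest_point_F[OF _ meas])
      have "continuous_on {0..T} (\<lambda>t. \<phi> t + w (V k) t)"
        by (intro continuous_on_add \<phi> w_cont[OF meas bd_B])
      then show "(\<lambda>t. \<phi> t + w (V k) t) \<in> borel_measurable (lebesgue_on {0..T})"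
        by (rule continuous_imp_measurable_on_sets_lebesgue) simp
    qed (use dom in simp)
    have bd': "norm (V (Suc k) t - D t) \<le> 2 * L * E t * (1 - 1 / 2 ^ Suc k)" if t: "t \<in> {0..T}" for t
    proof -
      have "norm (V (Suc k) t - D t) \<le> norm (V (Suc k) t - V k t) + norm (V k t - D t)"
        using norm_triangle_ineq[of "V (Suc k) t - V k t" "V k t - D t"] by simp
      also have "\<dots> \<le> L * E t / 2 ^ k + 2 * L * E t * (1 - 1 / 2 ^ k)"
        by (rule add_mono[OF step[OF t] bd[OF t]])
      also have "\<dots> = 2 * L * E t * (1 - 1 / 2 ^ Suc k)"
        by (simp add: field_simps)
      finally show ?thesis .
    qed
    have bd'_B: "norm (V (Suc k) t - D t) \<le> B" if "t \<in> {0..T}" for t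
      using bd'[OF that] le_B[OF that] by (rule order_trans)
    \<comment> \<open>Here the halving takes place: \<open>E_int\<close> with
      \<open>1 / 2 ^ k\<close> for \<open>B\<close>, after which the term with \<open>c\<close> is
      dropped.\<close>
    have w_step: "norm (w (V (Suc k)) t - w (V k) t) \<le> E t / 2 ^ Suc k" if t: "t \<in> {0..T}" for t
    proof -
      have "norm (w (V (Suc k)) t - w (V k) t) \<le> (1 / 2 ^ k) * (E t - c) / 2"
      proof (rule close_w[OF meas bd_B meas' bd'_B t E_int])
        show "0 \<le> t" using t by simp
        fix s assume "s \<in> {0..t}"
        then have "s \<in> {0..T}" using t by auto
        then show "norm (V (Suc k) s - V k s) \<le> L * (1 / 2 ^ k) * E s"
          using step[of s] by simp
      qed
      also have "\<dots> \<le> E t / 2 ^ Suc k"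
        using \<open>0 \<le> c\<close> by (simp add: field_simps)
      finally show ?thesis .
    qed
    have w_le': "norm (w (V (Suc k)) t) \<le> E t * (2 - 1 / 2 ^ Suc k)" if t: "t \<in> {0..T}" for t
    proof -
      have "norm (w (V (Suc k)) t) \<le> norm (w (V (Suc k)) t - w (V k) t) + norm (w (V k) t)"
        using norm_triangle_ineq[of "w (V (Suc k)) t - w (V k) t" "w (V k) t"] by simp
      also have "\<dots> \<le> E t / 2 ^ Suc k + E t * (2 - 1 / 2 ^ k)"
        by (rule add_mono[OF w_step[OF t] w_le[OF t]])
      also have "\<dots> = E t * (2 - 1 / 2 ^ Suc k)"
        by (simp add: field_simps)
      finally show ?thesis .
    qed
    have "norm (V (Suc (Suc k)) t - V (Suc k) t) \<le> L * E t / 2 ^ Suc k" if t: "t \<in> {0..T}" for t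
    proof -
      have dom': "\<phi> t + w (V (Suc k)) t \<in> U"
        using order_trans[OF w_le'[OF t] le_2E[OF t]] by (rule tube[OF t])
      \<comment> \<open>This velocity is admissible at the old position, so projecting it at the new
        one moves it by at most \<open>L\<close> times the change of position.\<close>
      have "V (Suc k) t \<in> F (\<phi> t + w (V k) t)"
        unfolding VS by (rule closest_point_in_F[OF dom[OF t]])
      from closest_point_F_le[OF dom[OF t] dom' this]
      have "norm (V (Suc (Suc k)) t - V (Suc k) t) \<le> L * norm (w (V (Suc k)) t - w (V k) t)"
        unfolding VS[of "Suc k"] by (simp add: norm_minus_commute)
      also have "\<dots> \<le> L * (E t / 2 ^ Suc k)"
        using w_step[OF t] L_pos by (intro mult_left_mono) auto
      finally show ?thesis by simp
    qed
    then show ?case using meas' bd' w_le' by blast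
  qed
  have V_meas: "V k \<in> borel_measurable (lebesgue_on {0..T})" for k using iterates by blast
  have V_le: "norm (V k t - D t) \<le> B" if "t \<in> {0..T}" for t k
    using iterates[of k] le_B[OF that, of k] that order_trans by blast
  have w_le: "norm (w (V k) t) \<le> 2 * norm z * exp (2 * L * T)" if "t \<in> {0..T}" for t k
    using iterates[of k] le_2E[OF that, of k] that order_trans by blast
  \<comment> \<open>\<open>E\<close> is replaced by its value at \<open>T\<close>. The convergence
    of the velocities becomes uniform in \<open>t\<close>, and integrals converge by a direct
    estimate.\<close>
  define M where "M = L * (c * exp (2 * L * T))"
  have "norm (V (Suc k) t - V k t) \<le> M / 2 ^ k" if "t \<in> {0..T}" for t k
  proof -
    have "norm (V (Suc k) t - V k t) \<le> L * E t / 2 ^ k" using iterates that by blast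
    also have "\<dots> \<le> M / 2 ^ k"
      unfolding M_def using E_le[OF that] L_pos by (intro divide_right_mono mult_left_mono) auto
    finally show ?thesis .
  qed
  then have "\<forall>t\<in>{0..T}. \<exists>l. (\<lambda>k. V k t) \<longlonglongrightarrow> l \<and> (\<forall>k. norm (V k t - l) \<le> 2 * M / 2 ^ k)"
    by (intro ballI geometric_steps_converge) auto
  from bchoice[OF this] obtain X where
    X: "\<forall>t\<in>{0..T}. (\<lambda>k. V k t) \<longlonglongrightarrow> X t \<and> (\<forall>k. norm (V k t - X t) \<le> 2 * M / 2 ^ k)" ..
  have X_lim: "(\<lambda>k. V k t) \<longlonglongrightarrow> X t" and X_le: "norm (V k t - X t) \<le> 2 * M / 2 ^ k" if "t \<in> {0..T}" for t k
    using X that by blast+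
  have X_meas: "X \<in> borel_measurable (lebesgue_on {0..T})"
    by (rule borel_measurable_LIMSEQ_metric[OF V_meas]) (use X_lim in simp)
  have X_B: "norm (X t - D t) \<le> B" if t: "t \<in> {0..T}" for t
    by (rule Lim_bounded[of "\<lambda>k. norm (V k t - D t)" _ 0])
       (intro tendsto_intros X_lim t, use V_le[OF t] in blast)
  have w_close: "norm (w (V k) t - w X t) \<le> t * (2 * M) / 2 ^ k" if t: "t \<in> {0..T}" for t k
  proof (rule close_w[OF X_meas X_B V_meas V_le t])
    show "((\<lambda>_. 2 * M / 2 ^ k) has_integral t * (2 * M) / 2 ^ k) {0..t}"
      using has_integral_const_real[of "2 * M / 2 ^ k" 0 t] t by simp
    fix s assume "s \<in> {0..t}"
    then show "norm (V k s - X s) \<le> 2 * M / 2 ^ k" using t by (intro X_le) auto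
  qed
  have w_null: "(\<lambda>k. norm (w (V k) t - w X t)) \<longlonglongrightarrow> 0" if t: "t \<in> {0..T}" for t
  proof (rule Lim_null_comparison)
    show "\<forall>\<^sub>F k in sequentially. norm (norm (w (V k) t - w X t)) \<le> t * (2 * M) / 2 ^ k"
      using w_close[OF t] by simp
    show "(\<lambda>k. t * (2 * M) / 2 ^ k) \<longlonglongrightarrow> 0" by (rule LIMSEQ_divide_realpow_zero) simp
  qed
  have w_X_le: "norm (w X t) \<le> 2 * norm z * exp (2 * L * T)" if t: "t \<in> {0..T}" for t
  proof (rule Lim_bounded[of "\<lambda>k. norm (w (V k) t)" _ 0])
    show "(\<lambda>k. norm (w (V k) t)) \<longlonglongrightarrow> norm (w X t)"
      using w_null[OF t] unfolding tendsto_norm_zero_iff by (intro tendsto_norm) (rule LIM_zero_cancel)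
  qed (use w_le[OF t] in blast)
  have "X t \<in> F (\<phi> t + w X t)" if t: "t \<in> {0..T}" for t
  proof -
    have y: "\<phi> t + w X t \<in> U" by (rule tube[OF t w_X_le[OF t]])
    have y_k: "\<phi> t + w (V k) t \<in> U" for k by (rule tube[OF t w_le[OF t]])
    \<comment> \<open>The iterates are admissible at varying positions. The Lipschitz condition
      moves them into the single closed set at the limit position, at a cost tending to 0, so the
      limit is admissible too.\<close>
    have "\<forall>k. \<exists>p. p \<in> F (\<phi> t + w X t) \<and> norm (V (Suc k) t - p) \<le> L * norm (w (V k) t - w X t)"
    proof
      fix k
      have "V (Suc k) t \<in> F (\<phi> t + w (V k) t)"
        unfolding VS by (rule closest_point_in_F[OF y_k])
      from lipschitz_F[OF y_k y this]
      show "\<exists>p. p \<in> F (\<phi> t + w X t) \<and> norm (V (Suc k) t - p) \<le> L * norm (w (V k) t - w X t)"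
        by auto
    qed
    from choice[OF this] obtain p where p: "\<forall>k. p k \<in> F (\<phi> t + w X t) \<and>
        norm (V (Suc k) t - p k) \<le> L * norm (w (V k) t - w X t)" ..
    have "(\<lambda>k. V (Suc k) t - p k) \<longlonglongrightarrow> 0"
    proof (rule Lim_null_comparison)
      show "\<forall>\<^sub>F k in sequentially. norm (V (Suc k) t - p k) \<le> L * norm (w (V k) t - w X t)"
        using p by simp
      show "(\<lambda>k. L * norm (w (V k) t - w X t)) \<longlonglongrightarrow> 0"
        using tendsto_mult_left[OF w_null[OF t], of L] by simp
    qed
    from tendsto_diff[OF LIMSEQ_Suc[OF X_lim[OF t]] this]
    have "p \<longlonglongrightarrow> X t" by simp
    then show ?thesis
      using closed_F[OF y] p closed_sequentially by blast
  qed
  then have X_F: "D t + (X t - D t) \<in> F (\<phi> t + (z + integral {0..t} (\<lambda>s. X s - D s)))"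
    if "t \<in> {0..T}" for t
    using that by (simp add: w_def)
  show thesis
  proof (rule that[of "\<lambda>t. X t - D t"])
    show "(\<lambda>t. X t - D t) integrable_on {0..T}"
      by (rule int[OF X_meas X_B]) (use \<open>0 \<le> T\<close> in auto)
  qed (use X_B w_X_le X_F in \<open>simp_all add: B_def w_def\<close>)
qed

text \<open>Adding the correction \<open>w\<close> displaces the solution by at most
  \<open>2 * norm z * exp (2 * L * T)\<close>. Since \<open>w\<close> is Lipschitz, the sum stays
  absolutely continuous, and almost everywhere its derivative is \<open>D t + u t\<close>.\<close>

lemma di_solution_perturbation:
  assumes "0 \<le> T" and sol: "di_solution U F {0..T} \<phi>" and "0 < \<epsilon>"
  obtains \<delta> where "0 < \<delta>"
    "\<And>x. norm (x - \<phi> 0) < \<delta> \<Longrightarrow> \<exists>\<psi>. di_solution U F {0..T} \<psi> \<and> \<psi> 0 = x \<and> norm (\<psi> T - \<phi> T) < \<epsilon>"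
proof -
  have in_U: "\<phi> ` {0..T} \<subseteq> U" and ac: "abs_continuous_on {0..T} \<phi>"
    and der: "AE t in lborel. t \<in> {0<..<T} \<longrightarrow> (\<exists>v \<in> F (\<phi> t). (\<phi> has_vector_derivative v) (at t))"
    using sol unfolding di_solution_iff_interior interior_atLeastAtMost_real by blast+
  have "abs_continuous_on_cbox 0 T \<phi>"
    using ac \<open>0 \<le> T\<close> by (simp add: abs_continuous_on_def)
  then have cont: "continuous_on {0..T} \<phi>" by (rule abs_continuous_on_cbox_imp_continuous_on)
  obtain D0 where D0: "D0 \<in> borel_measurable borel"
    "\<And>t v. t \<in> {0<..<T} \<Longrightarrow> (\<phi> has_vector_derivative v) (at t) \<Longrightarrow> D0 t = v"
    using measurable_derivative[OF cont] by blast
  \<comment> \<open>\<open>D0\<close> is arbitrary where \<open>\<phi>\<close> has no derivative.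
    Projecting makes the velocity admissible at every time of the interval and leaves it unchanged
    where the derivative already lies in \<open>F (\<phi> t)\<close>.\<close>
  define D where "D t = closest_point (F (\<phi> t)) (D0 t)" for t
  have dom: "\<phi> t \<in> U" if "t \<in> {0..T}" for t using in_U that by blast
  have D_meas: "D \<in> borel_measurable (lebesgue_on {0..T})"
    unfolding D_def
  proof (rule borel_measurable_closest_point_F)
    show "\<phi> \<in> borel_measurable (lebesgue_on {0..T})"
      using cont by (rule continuous_imp_measurable_on_sets_lebesgue) simp
    show "D0 \<in> borel_measurable (lebesgue_on {0..T})"
      using D0(1) by (intro measurable_restrict_space1 measurable_completion) simp
  qed (use dom in simp)
  have D_F: "D t \<in> F (\<phi> t)" if "t \<in> {0..T}" for t
    unfolding D_def by (rule closest_point_in_F[OF dom[OF that]])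
  have der_D: "AE t in lborel. t \<in> {0<..<T} \<longrightarrow> (\<phi> has_vector_derivative D t) (at t)"
    using der
  proof (rule AE_mp, intro AE_I2 impI)
    fix t assume "t \<in> {0<..<T} \<longrightarrow> (\<exists>v \<in> F (\<phi> t). (\<phi> has_vector_derivative v) (at t))" and t: "t \<in> {0<..<T}"
    then obtain v where v: "v \<in> F (\<phi> t)" "(\<phi> has_vector_derivative v) (at t)" by blast
    have "D t = v" unfolding D_def D0(2)[OF t v(2)] by (rule closest_point_self[OF v(1)])
    then show "(\<phi> has_vector_derivative D t) (at t)" using v(2) by simp
  qed
  obtain r where "0 < r" and r: "(\<Union>x\<in>\<phi> ` {0..T}. ball x r) \<subseteq> U"
    using compact_subset_open_imp_ball_epsilon_subset[OF compact_continuous_image[OF cont compact_Icc] open_U in_U] by blast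
  \<comment> \<open>The displacement bound then stays below \<open>r\<close>, so that the curve
    remains in \<open>U\<close>, and below \<open>\<epsilon>\<close> at the final time.\<close>
  define \<delta> where "\<delta> = min r \<epsilon> / (2 * exp (2 * L * T))"
  have "0 < \<delta>" using \<open>0 < r\<close> \<open>0 < \<epsilon>\<close> by (simp add: \<delta>_def)
  moreover have "\<exists>\<psi>. di_solution U F {0..T} \<psi> \<and> \<psi> 0 = x \<and> norm (\<psi> T - \<phi> T) < \<epsilon>"
    if x: "norm (x - \<phi> 0) < \<delta>" for x
  proof -
    define z where "z = x - \<phi> 0"
    have "norm z * (2 * exp (2 * L * T)) < min r \<epsilon>"
      using x unfolding z_def \<delta>_def by (subst (asm) pos_less_divide_eq) simp_all
    then have z: "2 * norm z * exp (2 * L * T) < min r \<epsilon>" by (simp add: mult.assoc mult.left_commute)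
    have tube: "\<phi> t + y \<in> U" if "t \<in> {0..T}" "norm y \<le> 2 * norm z * exp (2 * L * T)" for t y
    proof -
      have "\<phi> t + y \<in> ball (\<phi> t) r" using that z by (simp add: dist_norm)
      then show ?thesis using r that(1) by blast
    qed
    obtain u where u: "u integrable_on {0..T}"
      "\<And>t. t \<in> {0..T} \<Longrightarrow> norm (u t) \<le> 2 * L * norm z * exp (2 * L * T)"
      "\<And>t. t \<in> {0..T} \<Longrightarrow> norm (z + integral {0..t} u) \<le> 2 * norm z * exp (2 * L * T)"
      "\<And>t. t \<in> {0..T} \<Longrightarrow> D t + u t \<in> F (\<phi> t + (z + integral {0..t} u))"
      using filippov_correction[OF \<open>0 \<le> T\<close> cont D_meas D_F tube] by blast
    define w where "w t = z + integral {0..t} u" for t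
    define \<psi> where "\<psi> t = \<phi> t + w t" for t
    have u_int: "u integrable_on {s..t}" if "0 \<le> s" "t \<le> T" for s t
      using u(1) by (rule integrable_on_subinterval) (use that in auto)
    have w_lip: "norm (w t - w s) \<le> 2 * L * norm z * exp (2 * L * T) * (t - s)" if "0 \<le> s" "s \<le> t" "t \<le> T" for s t
    proof -
      have "integral {0..s} u + integral {s..t} u = integral {0..t} u"
        using that by (intro Henstock_Kurzweil_Integration.integral_combine u_int) auto
      then have "w t - w s = integral {s..t} u" unfolding w_def by (metis add_diff_cancel_left add_diff_cancel_left')
      also have "norm \<dots> \<le> integral {s..t} (\<lambda>_. 2 * L * norm z * exp (2 * L * T))"
        using that u_int u(2)
        by (intro Henstock_Kurzweil_Integration.integral_norm_bound_integral) auto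
      also have "\<dots> = 2 * L * norm z * exp (2 * L * T) * (t - s)"
        using that by simp
      finally show ?thesis .
    qed
    have "abs_continuous_on {0..T} \<psi>"
      unfolding abs_continuous_on_def
    proof (intro allI impI)
      fix a b :: real assume ab: "a \<le> b" "{a..b} \<subseteq> {0..T}"
      then have "0 \<le> a" "b \<le> T" by auto
      show "abs_continuous_on_cbox a b \<psi>"
        unfolding \<psi>_def
      proof (rule abs_continuous_on_cbox_add)
        show "abs_continuous_on_cbox a b \<phi>" using ac ab by (simp add: abs_continuous_on_def)
        show "abs_continuous_on_cbox a b w"
          by (rule abs_continuous_on_cbox_lipschitz, rule w_lip) (use \<open>0 \<le> a\<close> \<open>b \<le> T\<close> in auto)
      qed
    qed
    moreover have "\<psi> ` {0..T} \<subseteq> U"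
      using tube u(3) by (auto simp: \<psi>_def w_def)
    moreover have "AE t in lborel. t \<in> {0<..<T} \<longrightarrow> (\<exists>v \<in> F (\<psi> t). (\<psi> has_vector_derivative v) (at t))"
      using der_D indefinite_integral_has_vector_derivative_AE[OF u(1)]
    proof eventually_elim
      case (elim t)
      show ?case
      proof
        assume t: "t \<in> {0<..<T}"
        have "(\<psi> has_vector_derivative D t + (0 + u t)) (at t)"
          unfolding \<psi>_def w_def
          by (intro has_vector_derivative_add has_vector_derivative_const) (use elim t in auto)
        moreover have "D t + (0 + u t) \<in> F (\<psi> t)" using u(4)[of t] t by (simp add: \<psi>_def w_def)
        ultimately show "\<exists>v \<in> F (\<psi> t). (\<psi> has_vector_derivative v) (at t)" by blast
      qed
    qed
    ultimately have "di_solution U F {0..T} \<psi>"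
      unfolding di_solution_iff_interior interior_atLeastAtMost_real by (simp add: is_interval_cc)
    moreover have "\<psi> 0 = x" by (simp add: \<psi>_def w_def z_def)
    moreover have "norm (\<psi> T - \<phi> T) < \<epsilon>"
      using u(3)[of T] z \<open>0 \<le> T\<close> by (simp add: \<psi>_def w_def)
    ultimately show ?thesis by blast
  qed
  ultimately show thesis using that by blast
qed

section \<open>Lower semicontinuity of reachability\<close>

lemma reachable_perturbation_nonneg:
  assumes "0 \<le> t" "reachable U F t x y" "0 < \<epsilon>"
  obtains \<delta> where "0 < \<delta>" "\<And>x'. x' \<in> ball x \<delta> \<Longrightarrow> \<exists>y'\<in>ball y \<epsilon>. reachable U F t x' y'"
proof -
  have ivl: "{min 0 t..max 0 t} = {0..t}" using \<open>0 \<le> t\<close> by simp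
  obtain \<phi> where \<phi>: "di_solution U F {0..t} \<phi>" "\<phi> 0 = x" "\<phi> t = y"
    using assms(2) unfolding reachable_def ivl by blast
  obtain \<delta> where "0 < \<delta>" and \<delta>: "\<And>x'. norm (x' - \<phi> 0) < \<delta> \<Longrightarrow>
      \<exists>\<psi>. di_solution U F {0..t} \<psi> \<and> \<psi> 0 = x' \<and> norm (\<psi> t - \<phi> t) < \<epsilon>"
    using di_solution_perturbation[OF \<open>0 \<le> t\<close> \<phi>(1) \<open>0 < \<epsilon>\<close>] by blast
  have "\<exists>y'\<in>ball y \<epsilon>. reachable U F t x' y'" if "x' \<in> ball x \<delta>" for x'
    using \<delta>[of x'] that \<phi>(2,3) unfolding reachable_def ivl
    by (auto simp: dist_norm norm_minus_commute)
  then show thesis using that \<open>0 < \<delta>\<close> by blast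
qed

text \<open>The hypotheses are symmetric under negation of velocities, so perturbation for negative
  times follows from the forward case applied to the reversed inclusion.\<close>

lemma lipschitz_inclusion_uminus: "lipschitz_inclusion U (\<lambda>x. uminus ` F x) L"
proof
  show "closed (uminus ` F x)" if "x \<in> U" for x
    using closed_F[OF that] by (rule closed_negations)
  show "convex (uminus ` F x)" if "x \<in> U" for x
    using convex_F[OF that] by (rule convex_negations)
  fix x x' v assume x: "x \<in> U" "x' \<in> U" and "v \<in> uminus ` F x"
  then obtain y where y: "y \<in> F x" "v = - y" by blast
  obtain y' where y': "y' \<in> F x'" "norm (y - y') \<le> L * norm (x - x')"
    using lipschitz_F[OF x y(1)] by blast
  have "norm (- y - - y') \<le> L * norm (x - x')"
    using y'(2) by (simp add: norm_minus_commute)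
  then show "\<exists>v'\<in>uminus ` F x'. norm (v - v') \<le> L * norm (x - x')"
    unfolding y(2) using y'(1) by blast
qed (use open_U nonempty_F L_pos in auto)

lemma reachable_perturbation:
  assumes xy: "reachable U F t x y" and "0 < \<epsilon>"
  obtains \<delta> where "0 < \<delta>" "\<And>x'. x' \<in> ball x \<delta> \<Longrightarrow> \<exists>y'\<in>ball y \<epsilon>. reachable U F t x' y'"
proof (cases "0 \<le> t")
  case True
  then show thesis using reachable_perturbation_nonneg[OF _ xy \<open>0 < \<epsilon>\<close>] that by blast
next
  case False
  then have neg: "0 \<le> - t" by simp
  interpret rev: lipschitz_inclusion U "\<lambda>x. uminus ` F x" L by (rule lipschitz_inclusion_uminus)
  obtain \<delta> where "0 < \<delta>" and \<delta>: "\<And>x'. x' \<in> ball x \<delta> \<Longrightarrow>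
      \<exists>y'\<in>ball y \<epsilon>. reachable U (\<lambda>x. uminus ` F x) (- t) x' y'"
    using rev.reachable_perturbation_nonneg[OF neg reachable_reflect(1)[OF xy] \<open>0 < \<epsilon>\<close>] by blast
  have "reachable U F t x' y'" if "reachable U (\<lambda>x. uminus ` F x) (- t) x' y'" for x' y'
    using reachable_reflect(1)[OF that] by (simp add: uminus_uminus_image)
  then show thesis using that[OF \<open>0 < \<delta>\<close>] \<delta> by blast
qed

text \<open>Perturbation is applied backwards: \<open>y\<close> reaches \<open>x\<close> in time
  \<open>- t\<close>, so every point of some ball around \<open>y\<close> reaches a point of
  \<open>A\<close> in time \<open>- t\<close>, and reversal puts that ball into the image.\<close>

lemma open_solution_image:
  assumes "open A"
  shows "open (solution_image U F A t)"
  unfolding open_contains_ball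
proof
  fix y assume "y \<in> solution_image U F A t"
  then obtain x where x: "x \<in> A" "reachable U F t x y" unfolding solution_image_eq by blast
  obtain \<epsilon> where "0 < \<epsilon>" and \<epsilon>: "ball x \<epsilon> \<subseteq> A" using \<open>open A\<close> x(1) openE by blast
  obtain \<delta> where "0 < \<delta>" and \<delta>: "\<And>y'. y' \<in> ball y \<delta> \<Longrightarrow> \<exists>x'\<in>ball x \<epsilon>. reachable U F (- t) y' x'"
    using reachable_perturbation[OF reachable_reflect(2)[OF x(2)] \<open>0 < \<epsilon>\<close>] by blast
  have "ball y \<delta> \<subseteq> solution_image U F A t"
  proof
    fix y' assume "y' \<in> ball y \<delta>"
    then obtain x' where "x' \<in> A" "reachable U F (- t) y' x'" using \<delta> \<epsilon> by blast
    then show "y' \<in> solution_image U F A t"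
      using reachable_reflect(2)[of U F "- t" y' x'] unfolding solution_image_eq by auto
  qed
  then show "\<exists>e>0. ball y e \<subseteq> solution_image U F A t" using \<open>0 < \<delta>\<close> by blast
qed

end

section \<open>Invariant measures\<close>

lemma solution_image_subset: "solution_image U F A t \<subseteq> U"
  unfolding solution_image_eq using reachable_in_domain by blast

locale invariant_inclusion = lipschitz_inclusion +
  fixes \<mu>
  assumes invariant: "invariant_prob_measure U F \<mu>"
begin

lemma open_sets: "open A \<Longrightarrow> A \<subseteq> U \<Longrightarrow> A \<in> sets \<mu>"
  using invariant open_U unfolding invariant_prob_measure_def
  by (simp add: sets_restrict_space_iff)

text \<open>An open image belongs to \<open>sets \<mu>\<close>, where the completion agrees with
  \<open>\<mu>\<close>.\<close>

lemma emeasure_solution_image_open: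
  assumes "open A" "A \<subseteq> U"
  shows "emeasure \<mu> (solution_image U F A t) = emeasure \<mu> A"
proof -
  have "solution_image U F A t \<in> sets \<mu>"
    by (rule open_sets[OF open_solution_image[OF assms(1)] solution_image_subset])
  then have "emeasure (completion \<mu>) (solution_image U F A t) = emeasure \<mu> (solution_image U F A t)"
    by simp
  then show ?thesis
    using invariant open_sets[OF assms] unfolding invariant_prob_measure_def by auto
qed

lemma nonuniqueness_null_neighbourhood:
  assumes "x \<in> nonuniqueness_set U F"
  obtains B where "open B" "B \<subseteq> U" "x \<in> B" "emeasure \<mu> B = 0"
proof -
  obtain t y z where y: "reachable U F t x y" and z: "reachable U F t x z" and "y \<noteq> z"
    using nonuniqueness_set_branches[OF assms] by blast
  \<comment> \<open>Half the distance makes the open balls around \<open>y\<close> and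
    \<open>z\<close> disjoint.\<close>
  define \<epsilon> where "\<epsilon> = dist y z / 2"
  have "0 < \<epsilon>" using \<open>y \<noteq> z\<close> by (simp add: \<epsilon>_def)
  obtain \<delta>1 where \<delta>1: "0 < \<delta>1" "\<And>x'. x' \<in> ball x \<delta>1 \<Longrightarrow> \<exists>y'\<in>ball y \<epsilon>. reachable U F t x' y'"
    using reachable_perturbation[OF y \<open>0 < \<epsilon>\<close>] by blast
  obtain \<delta>2 where \<delta>2: "0 < \<delta>2" "\<And>x'. x' \<in> ball x \<delta>2 \<Longrightarrow> \<exists>z'\<in>ball z \<epsilon>. reachable U F t x' z'"
    using reachable_perturbation[OF z \<open>0 < \<epsilon>\<close>] by blast
  define B where "B = ball x \<delta>1 \<inter> ball x \<delta>2 \<inter> U"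
  have B: "open B" "B \<subseteq> U" "x \<in> B"
    using open_U reachable_in_domain(1)[OF y] \<delta>1(1) \<delta>2(1) by (auto simp: B_def)
  define P where "P y = solution_image U F B t \<inter> ball y \<epsilon>" for y
  have P: "open (P y)" "P y \<subseteq> U" for y
    unfolding P_def using open_solution_image[OF B(1)] solution_image_subset[of U F B t] by auto
  have large: "emeasure \<mu> B \<le> emeasure \<mu> (P y)"
    if near: "\<And>x'. x' \<in> B \<Longrightarrow> \<exists>y'\<in>ball y \<epsilon>. reachable U F t x' y'" for y
  proof -
    \<comment> \<open>Invariance at time \<open>- t\<close> turns the measure of this superset of
      \<open>B\<close> into that of \<open>P y\<close>.\<close>
    have "B \<subseteq> solution_image U F (P y) (- t)"
    proof
      fix x' assume x': "x' \<in> B"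
      then obtain y' where y': "y' \<in> ball y \<epsilon>" "reachable U F t x' y'" using near by blast
      then have "y' \<in> P y" using x' unfolding P_def solution_image_eq by blast
      then show "x' \<in> solution_image U F (P y) (- t)"
        using reachable_reflect(2)[OF y'(2)] unfolding solution_image_eq by blast
    qed
    then have "emeasure \<mu> B \<le> emeasure \<mu> (solution_image U F (P y) (- t))"
      by (rule emeasure_mono) (rule open_sets[OF open_solution_image[OF P(1)] solution_image_subset])
    then show ?thesis using emeasure_solution_image_open[OF P] by simp
  qed
  have "P y \<inter> P z = {}"
    using disjoint_ballI[of \<epsilon> \<epsilon> y z] by (auto simp: P_def \<epsilon>_def)
  then have "emeasure \<mu> (P y) + emeasure \<mu> (P z) = emeasure \<mu> (P y \<union> P z)"
    by (intro plus_emeasure open_sets P)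
  also have "\<dots> \<le> emeasure \<mu> (solution_image U F B t)"
    by (rule emeasure_mono[OF _ open_sets[OF open_solution_image[OF B(1)] solution_image_subset]])
       (auto simp: P_def)
  also have "\<dots> = emeasure \<mu> B" by (rule emeasure_solution_image_open[OF B(1,2)])
  finally have "emeasure \<mu> (P y) + emeasure \<mu> (P z) \<le> emeasure \<mu> B" .
  moreover have "emeasure \<mu> B \<le> emeasure \<mu> (P y)"
    by (rule large, rule \<delta>1(2)) (simp add: B_def)
  moreover have "emeasure \<mu> B \<le> emeasure \<mu> (P z)"
    by (rule large, rule \<delta>2(2)) (simp add: B_def)
  ultimately have "emeasure \<mu> B + emeasure \<mu> B \<le> emeasure \<mu> B"
    by (meson add_mono order_trans)
  \<comment> \<open>Twice the measure being at most the measure forces 0 only because the measure is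
    finite.\<close>
  moreover have "emeasure \<mu> B \<noteq> \<infinity>"
    using invariant finite_measure.emeasure_finite[OF prob_space.finite_measure, of \<mu> B]
    unfolding invariant_prob_measure_def by simp
  ultimately have "emeasure \<mu> B = 0"
    by (cases "emeasure \<mu> B") (auto simp: ennreal_plus[symmetric] simp del: ennreal_plus)
  then show thesis using that B by blast
qed

lemma open_null_cover:
  "\<exists>A. open A \<and> A \<subseteq> U \<and> saturation U F (nonuniqueness_set U F) \<subseteq> A \<and> emeasure \<mu> A = 0"
proof -
  define \<N> where "\<N> = {B. open B \<and> B \<subseteq> U \<and> emeasure \<mu> B = 0}"
  obtain \<C> where \<C>: "countable \<C>" "\<C> \<subseteq> \<N>" "\<Union>\<C> = \<Union>\<N>"
  proof (rule Lindelof[of \<N>])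
    show "open S" if "S \<in> \<N>" for S using that by (simp add: \<N>_def)
  qed
  have "(\<Union>B\<in>\<C>. B) \<in> null_sets \<mu>"
  proof (rule null_sets_UN'[OF \<C>(1)])
    fix B assume "B \<in> \<C>"
    then have "open B" "B \<subseteq> U" "emeasure \<mu> B = 0" using \<C>(2) by (auto simp: \<N>_def)
    then show "B \<in> null_sets \<mu>" using open_sets by (intro null_setsI)
  qed
  then have "emeasure \<mu> (\<Union>\<N>) = 0" using \<C>(3) by auto
  moreover have "saturation U F (nonuniqueness_set U F) \<subseteq> \<Union>\<N>"
  proof
    fix y assume "y \<in> saturation U F (nonuniqueness_set U F)"
    then obtain x t where x: "x \<in> nonuniqueness_set U F" "reachable U F t x y"
      by (rule saturation_reachable)
    obtain B where B: "open B" "B \<subseteq> U" "x \<in> B" "emeasure \<mu> B = 0"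
      by (rule nonuniqueness_null_neighbourhood[OF x(1)])
    have "solution_image U F B t \<in> \<N>"
      unfolding \<N>_def
      using open_solution_image[OF B(1)] solution_image_subset[of U F B t]
        emeasure_solution_image_open[OF B(1,2)] B(4) by simp
    moreover have "y \<in> solution_image U F B t" using x(2) B(3) unfolding solution_image_eq by blast
    ultimately show "y \<in> \<Union>\<N>" by blast
  qed
  moreover have "open (\<Union>\<N>)" "\<Union>\<N> \<subseteq> U" unfolding \<N>_def by auto
  ultimately show ?thesis by blast
qed

end

text \<open>With no admissible velocity the derivative condition fails at every time, so the
  interval between 0 and \<open>t\<close> must be a null set and hence a point.\<close>

lemma reachable_only_at_zero_if_empty:
  assumes "reachable U F t x y" and empty: "\<And>x. x \<in> U \<Longrightarrow> F x = {}"
  shows "t = 0"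
proof (rule ccontr)
  assume "t \<noteq> 0"
  obtain \<phi> where "di_solution U F {min 0 t..max 0 t} \<phi>"
    using assms(1) unfolding reachable_def by blast
  then have in_U: "\<phi> ` {min 0 t..max 0 t} \<subseteq> U"
    and "AE s in lborel. s \<in> {min 0 t..max 0 t} \<longrightarrow>
      (\<exists>v \<in> F (\<phi> s). (\<phi> has_vector_derivative v) (at s within {min 0 t..max 0 t}))"
    unfolding di_solution_def by blast+
  then have "AE s in lborel. s \<notin> {min 0 t..max 0 t}"
  proof (elim AE_mp, intro AE_I2 impI notI)
    fix s assume s: "s \<in> {min 0 t..max 0 t}" "s \<in> {min 0 t..max 0 t} \<longrightarrow>
      (\<exists>v \<in> F (\<phi> s). (\<phi> has_vector_derivative v) (at s within {min 0 t..max 0 t}))"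
    have "F (\<phi> s) = {}" using in_U s(1) by (intro empty) blast
    then show False using s by blast
  qed
  then have "negligible (cbox (min 0 t) (max 0 t))"
    unfolding AE_lborel_iff_negligible cbox_interval by (simp only: not_not Collect_mem_eq)
  then have "box (min 0 t) (max 0 t) = {}" by (simp only: negligible_interval)
  then show False using \<open>t \<noteq> 0\<close> by (simp add: box_real min_def max_def split: if_splits)
qed

text \<open>Branching would take place at time 0, where only the starting point itself is
  reached.\<close>

lemma nonuniqueness_set_empty:
  assumes "\<And>x. x \<in> U \<Longrightarrow> F x = {}"
  shows "nonuniqueness_set U F = {}"
proof (rule ccontr)
  assume "nonuniqueness_set U F \<noteq> {}"
  then obtain x where "x \<in> nonuniqueness_set U F" by blast
  then obtain t y z where yz: "reachable U F t x y" "reachable U F t x z" "y \<noteq> z"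
    by (rule nonuniqueness_set_branches)
  then have "t = 0" using assms by (intro reachable_only_at_zero_if_empty[of U F t x y]) auto
  then show False using yz unfolding reachable_def by auto
qed

theorem theorem2:
  fixes U :: "(real^'n) set" and F :: "real^'n \<Rightarrow> (real^'n) set" and \<mu> :: "(real^'n) measure"
  assumes "open U"
    and "\<And>x. x \<in> U \<Longrightarrow> closed (F x)"
    and "\<And>x. x \<in> U \<Longrightarrow> convex (F x)"
    and "lipschitzian_on U F"
    and "invariant_prob_measure U F \<mu>"
  shows "\<exists>A. open A \<and> A \<subseteq> U \<and> saturation U F (nonuniqueness_set U F) \<subseteq> A \<and> emeasure \<mu> A = 0"
proof -
  obtain L where "0 < L" and L: "\<And>x x'. x \<in> U \<Longrightarrow> x' \<in> U \<Longrightarrow>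
      F x \<subseteq> {y + (L * norm (x - x')) *\<^sub>R b | y b. y \<in> F x' \<and> b \<in> cball 0 1}"
    using assms(4) unfolding lipschitzian_on_def by blast
  show ?thesis \<comment> \<open>By the Lipschitz condition \<open>F\<close> has empty values everywhere on \<open>U\<close> or nowhere.\<close>
  proof (cases "\<exists>x\<in>U. F x = {}")
    case True
    then have "F x = {}" if "x \<in> U" for x using L[OF that] by blast
    then have "nonuniqueness_set U F = {}" by (rule nonuniqueness_set_empty)
    then show ?thesis by (intro exI[of _ "{}"]) (simp add: saturation_def)
  next
    case False
    interpret invariant_inclusion U F L \<mu>
    proof
      fix x x' v assume "x \<in> U" "x' \<in> U" "v \<in> F x"
      then obtain y b where yb: "v = y + (L * norm (x - x')) *\<^sub>R b" "y \<in> F x'" "norm b \<le> 1"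
        using L[of x x'] by auto
      have "norm (v - y) = L * norm (x - x') * norm b" using yb(1) \<open>0 < L\<close> by simp
      also have "\<dots> \<le> L * norm (x - x') * 1"
        using yb(3) \<open>0 < L\<close> by (intro mult_left_mono) auto
      finally show "\<exists>v'\<in>F x'. norm (v - v') \<le> L * norm (x - x')" using yb(2) by auto
    qed (use assms False \<open>0 < L\<close> in auto)
    show ?thesis by (rule open_null_cover)
  qed
qed

end
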